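(* Let $\theta\in[0,\pi)\setminus\{\pi/2\}$, $\kappa(\theta):=\gamma-\log2+\tan\theta$, and let $K_\theta(t):=\lim_{R\to\infty}\frac{1}{2\pi i}\int_{-iR}^{iR}e^{t\zeta}(\log\sqrt\zeta+\kappa(\theta))^{-1}d\zeta$. Define $$\mathrm{Tr}_1\big(N'E_+*_tK_\theta*_tN'E_+\big)(t):=\int_0^1\int_0^t\int_0^{s}N'E_+(x,t-s)\,K_\theta(s-r)\,N'E_+(x,r)\,dr\,ds\,dx.$$ Then there exist constants $b_j$, $j\ge0$, such that for every $N\in\mathbb N$, as $t\to0^+$, $$\mathrm{Tr}_1\big(N'E_+*_tK_\theta*_tN'E_+\big)(t)=\sum_{j=0}^{N-1}b_jt^j+\frac1\pi\,\mathrm{Im}\left(\int_1^\infty\frac{e^{-ty}}{y}\big(\log y+i\pi+2\kappa(\theta)\big)^{-1}dy\right)+O(t^N).$$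
   Context: $N'E_+(x,t):=\frac{\sqrt x}{2t}\exp(-\frac{x^2}{4t})$ for $x,t>0$; $\gamma$ is the Euler–Mascheroni constant; $\sqrt\zeta$ and $\log$ denote principal branches on $\mathbb C\setminus(-\infty,0]$, continued to the imaginary axis away from $0$. *)

theory Defs
  imports "HOL-Analysis.Analysis" "HOL-Library.Landau_Symbols"
begin

definition NE :: "real \<Rightarrow> real \<Rightarrow> real" where
  "NE x t = sqrt x / (2 * t) * exp (- (x ^ 2) / (4 * t))"

definition kappa :: "real \<Rightarrow> real" where
  "kappa \<theta> = euler_mascheroni - ln 2 + tan \<theta>"

text \<open>K_theta(t) = lim_{R->oo} 1/(2 pi i) int_{-iR}^{iR} e^{t zeta} (log sqrt zeta + kappa)^{-1} d zeta,
  parametrised by zeta = i y, d zeta = i dy.\<close>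
definition Kth :: "real \<Rightarrow> real \<Rightarrow> complex" where
  "Kth \<theta> t = Lim at_top (\<lambda>R::real.
     (1 / (2 * of_real pi * \<i>)) *
     integral {-R..R} (\<lambda>y::real. exp (of_real t * (\<i> * of_real y)) *
        inverse (Ln (csqrt (\<i> * of_real y)) + of_real (kappa \<theta>)) * \<i>))"

definition Tr1 :: "real \<Rightarrow> real \<Rightarrow> complex" where
  "Tr1 \<theta> t = integral {0..1} (\<lambda>x::real. integral {0..t} (\<lambda>s::real.
      integral {0..s} (\<lambda>r::real.
        of_real (NE x (t - s)) * Kth \<theta> (s - r) * of_real (NE x r))))"

end

theory Submission
  imports Defs "HOL-Complex_Analysis.Cauchy_Integral_Theorem" "HOL-Real_Asymp.Real_Asymp"
begin

text \<open>
  Write \<open>c = 2 \<kappa>(\<theta>)\<close>. Rotating the contour onto the branch cut gives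
  \<open>K(t) = 2 \<integral>\<^sub>0\<^sup>\<infinity> exp (-ty) w(y) dy\<close> with \<open>w(y) = 1 / ((ln y + c)\<^sup>2 + \<pi>\<^sup>2)\<close>. The integrand of the
  trace is then nonnegative and Tonelli turns the trace into \<open>\<integral>\<^sub>0\<^sup>t K(u) G(t - u) du\<close>, where \<open>G(a)\<close> is the
  integral of \<open>N'E(x,\<cdot>) * N'E(x,\<cdot>)\<close> over \<open>x \<in> [0,1]\<close>. The same integral over all \<open>x > 0\<close> equals \<open>1/2\<close>
  exactly, and the part \<open>x > 1\<close> is at most \<open>exp (-1/a) / 2\<close>. Hence up to \<open>O(t\<^sup>N)\<close> the trace is
  \<open>1/2 \<integral>\<^sub>0\<^sup>t K = \<integral>\<^sub>0\<^sup>\<infinity> (1 - exp (-ty)) w(y) / y dy\<close>. The part over \<open>(0,1)\<close> is a power series in \<open>t\<close>; on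
  \<open>[1,\<infinity>)\<close> the term \<open>1\<close> contributes a constant and the term \<open>exp (-ty)\<close> is the stated logarithmic integral.
\<close>

section \<open>Rotation of the contour onto the branch cut\<close>

text \<open>Jordan's inequality: the sine is concave on \<open>[0, pi/2]\<close>, so its graph lies
  above the chord between the endpoints.\<close>

lemma jordan_sin_ge:
  fixes x :: real
  assumes "0 \<le> x" "x \<le> pi / 2"
  shows "2 * x / pi \<le> sin x"
proof -
  have "convex_on {0..pi/2} (\<lambda>x. - sin x)"
    by (rule convex_on_realI[where f' = "\<lambda>x. - cos x"])
       (auto intro!: derivative_eq_intros cos_monotone_0_pi_le)
  from convex_onD[OF this, of "2 * x / pi" 0 "pi / 2"] assms show ?thesis
    by (simp add: field_simps)
qed

text \<open>Boundedness and measurability are enough, so the integrands below can be handled up to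
  \<open>y = 0\<close> without continuity at the logarithmic singularity.\<close>

lemma integrable_on_bounded_borel:
  fixes f :: "real \<Rightarrow> 'a :: euclidean_space"
  assumes "f \<in> borel_measurable borel" "\<And>x. norm (f x) \<le> B"
  shows "f integrable_on {a..b}"
proof -
  have "set_integrable lborel {a..b} f"
    unfolding set_integrable_def
  proof (rule Bochner_Integration.integrable_bound)
    show "integrable lborel (\<lambda>x. B * indicator {a..b} x :: real)"
      by (intro integrable_mult_right integrable_real_indicator) (auto simp: emeasure_lborel_Icc_eq)
    have "0 \<le> B" using assms(2) norm_ge_zero order_trans by blast
    then show "AE x in lborel. norm (indicat_real {a..b} x *\<^sub>R f x)
         \<le> norm (B * indicator {a..b} x)"
      using assms(2) by (auto simp: indicator_def)
  qed (use assms(1) in measurable)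
  then show ?thesis by (rule set_borel_integral_eq_integral)
qed

text \<open>Half the integrand of \<open>Kth\<close> at \<open>zeta = i y\<close>,
  \<open>y > 0\<close>, when \<open>c\<close> is twice \<open>kappa\<close>: the square root halves
  the logarithm, and doubling clears this factor.\<close>

definition on_imag :: "real \<Rightarrow> real \<Rightarrow> real \<Rightarrow> complex" where
  "on_imag c t y = exp (\<i> * of_real (t * y)) / (of_real (ln y + c) + \<i> * of_real (pi / 2))"

text \<open>The analytic continuation of \<open>on_imag\<close> in its last argument, evaluated at
  \<open>i y\<close>; the leading \<i> is the derivative of the turned path. The point
  \<open>zeta\<close> then lies on the upper side of the cut, where the logarithm has imaginary part
  \<open>pi\<close>.\<close>

definition on_cut :: "real \<Rightarrow> real \<Rightarrow> real \<Rightarrow> complex" where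
  "on_cut c t y = \<i> * exp (- of_real (t * y)) / (of_real (ln y + c) + \<i> * of_real pi)"

lemma cmod_add_imag_ge: "\<bar>b\<bar> \<le> cmod (of_real a + \<i> * of_real b)"
  using abs_Im_le_cmod[of "of_real a + \<i> * of_real b"] by simp

lemma cmod_add_real_ge: "\<bar>a\<bar> \<le> cmod (of_real a + \<i> * of_real b)"
  using abs_Re_le_cmod[of "of_real a + \<i> * of_real b"] by simp

lemma on_imag_le: "cmod (on_imag c t y) \<le> 2 / pi"
proof -
  have "cmod (on_imag c t y) = 1 / cmod (of_real (ln y + c) + \<i> * of_real (pi / 2))"
    by (simp add: on_imag_def norm_divide)
  also have "\<dots> \<le> 1 / (pi / 2)"
    using cmod_add_imag_ge[of "pi / 2" "ln y + c"] by (intro frac_le) auto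
  finally show ?thesis by simp
qed

lemma on_cut_le:
  assumes "0 \<le> t * y" shows "cmod (on_cut c t y) \<le> exp (- (t * y)) / pi"
proof -
  have "cmod (on_cut c t y) = exp (- (t * y)) / cmod (of_real (ln y + c) + \<i> * of_real pi)"
    by (simp add: on_cut_def norm_divide norm_mult)
  also have "\<dots> \<le> exp (- (t * y)) / pi"
    using cmod_add_imag_ge[of pi "ln y + c"] by (intro frac_le) auto
  finally show ?thesis .
qed

lemma on_imag_measurable [measurable]: "on_imag c t \<in> borel_measurable borel"
  unfolding on_imag_def by measurable

lemma on_cut_measurable [measurable]: "on_cut c t \<in> borel_measurable borel"
  unfolding on_cut_def by measurable

lemma on_imag_integrable: "on_imag c t integrable_on {a..b}"
  by (rule integrable_on_bounded_borel[OF on_imag_measurable on_imag_le])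

lemma on_cut_integrable:
  assumes "0 < t" "0 \<le> a" shows "on_cut c t integrable_on {a..b}"
proof -
  \<comment> \<open>For negative \<open>y\<close> the exponential grows, so the integrand is frozen
    there to obtain one bound on the whole line.\<close>
  have "(\<lambda>y. on_cut c t (max 0 y)) integrable_on {a..b}"
  proof (rule integrable_on_bounded_borel[where B = "1 / pi"])
    fix y :: real
    have "cmod (on_cut c t (max 0 y)) \<le> exp (- (t * max 0 y)) / pi"
      using assms by (intro on_cut_le) auto
    also have "\<dots> \<le> 1 / pi" using assms by (intro divide_right_mono) auto
    finally show "cmod (on_cut c t (max 0 y)) \<le> 1 / pi" .
  qed measurable
  then show ?thesis
    by (rule integrable_eq) (use assms in \<open>auto simp: max_def\<close>)
qed

text \<open>In the variable \<open>z = ln w\<close> the quarter annulus becomes a rectangle inside a half-plane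
  on which the integrand is holomorphic, so a primitive replaces the contour integral.\<close>

lemma quarter_turn:
  fixes c t :: real
  assumes t: "0 < t"
  obtains P :: "complex \<Rightarrow> complex" where
    "\<And>e R. 0 < e \<Longrightarrow> e \<le> R \<Longrightarrow>
       (on_imag c t has_integral P (of_real (ln R)) - P (of_real (ln e))) {e..R}"
    "\<And>e R. 0 < e \<Longrightarrow> e \<le> R \<Longrightarrow> (on_cut c t has_integral
       P (of_real (ln R) + \<i> * of_real (pi / 2)) - P (of_real (ln e) + \<i> * of_real (pi / 2))) {e..R}"
    "\<And>r. 0 < r \<Longrightarrow> cmod (P (of_real (ln r) + \<i> * of_real (pi / 2)) - P (of_real (ln r))) \<le> r"
    "\<And>r. 0 < r \<Longrightarrow> 0 < ln r + c \<Longrightarrow>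
       cmod (P (of_real (ln r) + \<i> * of_real (pi / 2)) - P (of_real (ln r))) \<le> pi / (2 * t) / (ln r + c)"
proof -
  \<comment> \<open>The integrand in the variable \<open>z = ln w\<close>; the summand
    \<open>z\<close> in the exponent comes from \<open>dw = exp z dz\<close>.\<close>
  define h where "h z = exp (\<i> * of_real t * exp z + z) / (z + of_real c + \<i> * of_real (pi / 2))" for z
  \<comment> \<open>In this half-plane the denominator of \<open>h\<close> has positive imaginary
    part, and the strip between heights \<open>0\<close> and \<open>pi/2\<close> lies inside
    it.\<close>
  define S where "S = {z. Im z > - (pi / 2)}"
  have S: "convex S" "open S"
    using convex_halfspace_Im_gt open_halfspace_Im_gt by (auto simp: S_def)
  have nz: "z + of_real c + \<i> * of_real (pi / 2) \<noteq> 0" if "z \<in> S" for z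
  proof
    assume "z + of_real c + \<i> * of_real (pi / 2) = 0"
    then have "Im (z + of_real c + \<i> * of_real (pi / 2)) = 0" by simp
    with that show False by (simp add: S_def)
  qed
  have "h holomorphic_on S" unfolding h_def using nz by (intro holomorphic_intros) auto
  then obtain P where P: "\<And>z. z \<in> S \<Longrightarrow> (P has_field_derivative h z) (at z)"
    using holomorphic_convex_primitive'[OF S] at_within_open[OF _ S(2)] by metis
  \<comment> \<open>Horizontal lines in the \<open>z\<close>-plane are rays in the
    \<open>w\<close>-plane: height \<open>0\<close> gives \<open>on_imag\<close>, height
    \<open>pi/2\<close> gives \<open>on_cut\<close>.\<close>
  have ray: "((\<lambda>y. P (of_real (ln y) + \<i> * of_real b)) has_vector_derivative
        of_real (1 / y) * h (of_real (ln y) + \<i> * of_real b)) (at y within T)"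
    if "0 < y" "0 \<le> b" for y b T
  proof -
    have "((\<lambda>y. of_real (ln y) + \<i> * of_real b) has_vector_derivative (of_real (1 / y) :: complex)) (at y within T)"
      using that by (auto intro!: derivative_eq_intros simp: has_real_derivative_iff_has_vector_derivative[symmetric])
    moreover have "of_real (ln y) + \<i> * of_real b \<in> S"
      using that by (auto simp: S_def intro: order_less_le_trans[of _ 0])
    ultimately show ?thesis
      using field_vector_diff_chain_within[of "\<lambda>y. of_real (ln y) + \<i> * of_real b" "of_real (1 / y)" y T P]
        P[THEN has_field_derivative_at_within]
      unfolding o_def by blast
  qed
  have expln: "exp (complex_of_real (ln y)) = of_real y" if "0 < y" for y
    using that by (metis exp_ln exp_of_real)
  have h0: "of_real (1 / y) * h (of_real (ln y) + \<i> * of_real 0) = on_imag c t y" if "0 < y" for y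
    using that by (simp add: h_def on_imag_def exp_add expln mult_ac add_ac)
  have exppi2: "exp (\<i> * of_real (pi / 2)) = \<i>"
    using cis_pi_half unfolding cis_conv_exp .
  have h1: "of_real (1 / y) * h (of_real (ln y) + \<i> * of_real (pi / 2)) = on_cut c t y" if "0 < y" for y
  proof -
    have e: "exp (of_real (ln y) + \<i> * of_real (pi / 2)) = of_real y * \<i>"
      by (simp only: exp_add expln[OF that] exppi2)
    have d: "of_real (ln y) + \<i> * of_real (pi / 2) + of_real c + \<i> * of_real (pi / 2)
        = of_real (ln y + c) + \<i> * of_real pi"
      by (simp add: complex_eq_iff)
    have n: "exp (\<i> * of_real t * exp (of_real (ln y) + \<i> * of_real (pi / 2)) + (of_real (ln y) + \<i> * of_real (pi / 2)))
        = exp (- of_real (t * y)) * (of_real y * \<i>)"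
      by (subst exp_add, simp only: e) (simp add: algebra_simps)
    show ?thesis unfolding h_def n d on_cut_def using that by simp
  qed
  \<comment> \<open>Vertical segments in the \<open>z\<close>-plane are the arcs of radius
    \<open>r\<close>.\<close>
  have arc: "((\<lambda>b. \<i> * h (of_real (ln r) + \<i> * of_real b)) has_integral
      P (of_real (ln r) + \<i> * of_real (pi / 2)) - P (of_real (ln r))) {0..pi/2}" for r
  proof -
    have "((\<lambda>b. \<i> * h (of_real (ln r) + \<i> * of_real b)) has_integral
      P (of_real (ln r) + \<i> * of_real (pi / 2)) - P (of_real (ln r) + \<i> * of_real 0)) {0..pi/2}"
    proof (rule fundamental_theorem_of_calculus)
      fix b :: real assume b: "b \<in> {0..pi/2}"
      have "((\<lambda>b. of_real (ln r) + \<i> * of_real b) has_vector_derivative \<i>) (at b within {0..pi/2})"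
        by (auto intro!: derivative_eq_intros)
      moreover have "of_real (ln r) + \<i> * of_real b \<in> S"
        using b by (auto simp: S_def intro: order_less_le_trans[of _ 0])
      ultimately show "((\<lambda>b. P (of_real (ln r) + \<i> * of_real b)) has_vector_derivative
          \<i> * h (of_real (ln r) + \<i> * of_real b)) (at b within {0..pi/2})"
        using field_vector_diff_chain_within[of "\<lambda>b. of_real (ln r) + \<i> * of_real b" \<i> b "{0..pi/2}" P]
          P[THEN has_field_derivative_at_within]
        unfolding o_def by blast
    qed simp
    then show ?thesis by simp
  qed
  have arc_norm: "cmod (\<i> * h (of_real (ln r) + \<i> * of_real b)) =
      r * exp (- (t * r * sin b)) / cmod (of_real (ln r + c) + \<i> * of_real (b + pi / 2))"
    if "0 < r" for r b
  proof -
    have e: "exp (of_real (ln r) + \<i> * of_real b) = of_real r * cis b"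
      by (simp only: exp_add expln[OF that] cis_conv_exp)
    have d: "of_real (ln r) + \<i> * of_real b + of_real c + \<i> * of_real (pi / 2)
        = of_real (ln r + c) + \<i> * of_real (b + pi / 2)"
      by (simp add: complex_eq_iff)
    have "cmod (exp (\<i> * of_real t * exp (of_real (ln r) + \<i> * of_real b) + (of_real (ln r) + \<i> * of_real b)))
        = r * exp (- (t * r * sin b))"
      using that by (subst exp_add, simp only: e) (simp add: norm_mult algebra_simps)
    then show ?thesis unfolding h_def d by (simp add: norm_mult norm_divide)
  qed
  show thesis
  proof (rule that)
    fix e R :: real assume eR: "0 < e" "e \<le> R"
    have "((\<lambda>y. on_imag c t y) has_integral P (of_real (ln R) + \<i> * of_real 0) - P (of_real (ln e) + \<i> * of_real 0)) {e..R}"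
      using eR ray[of _ 0] h0 by (intro fundamental_theorem_of_calculus) auto
    then show "(on_imag c t has_integral P (of_real (ln R)) - P (of_real (ln e))) {e..R}"
      by simp
    show "(on_cut c t has_integral
       P (of_real (ln R) + \<i> * of_real (pi / 2)) - P (of_real (ln e) + \<i> * of_real (pi / 2))) {e..R}"
    proof (rule fundamental_theorem_of_calculus)
      fix y assume "y \<in> {e..R}"
      then have "0 < y" using eR by simp
      from ray[OF this, of "pi / 2"] h1[OF this]
      show "((\<lambda>y. P (of_real (ln y) + \<i> * of_real (pi / 2))) has_vector_derivative on_cut c t y) (at y within {e..R})"
        by simp
    qed fact
  next
    fix r :: real assume r: "0 < r"
    \<comment> \<open>Crude bound for small radii: the exponential is at most \<open>1\<close>, the
      denominator at least \<open>pi/2\<close>, and the segment has length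
      \<open>pi/2\<close>.\<close>
    have "cmod (P (of_real (ln r) + \<i> * of_real (pi / 2)) - P (of_real (ln r))) \<le>
      (r / (pi / 2)) * measure lborel (cbox 0 (pi / 2))"
    proof (rule has_integral_bound)
      show "((\<lambda>b. \<i> * h (of_real (ln r) + \<i> * of_real b)) has_integral
        P (of_real (ln r) + \<i> * of_real (pi / 2)) - P (of_real (ln r))) (cbox 0 (pi/2))"
        using arc by (simp add: cbox_interval)
      fix b assume "b \<in> cbox 0 (pi / 2)"
      then have b: "0 \<le> b" "b \<le> pi / 2" by auto
      have "0 \<le> sin b" using b by (intro sin_ge_zero) auto
      then show "cmod (\<i> * h (of_real (ln r) + \<i> * of_real b)) \<le> r / (pi / 2)"
        unfolding arc_norm[OF r] using cmod_add_imag_ge[of "b + pi / 2" "ln r + c"] b r t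
        by (intro frac_le) (auto simp: intro: order_trans[rotated])
    qed (use r in auto)
    then show "cmod (P (of_real (ln r) + \<i> * of_real (pi / 2)) - P (of_real (ln r))) \<le> r"
      by simp
  next
    fix r :: real assume r: "0 < r" "0 < ln r + c"
    \<comment> \<open>The rate from Jordan's inequality, \<open>t r sin b \<ge> k b\<close>.
      Integrating \<open>exp (- k b)\<close> yields at most \<open>1/k\<close>, which cancels the
      factor \<open>r\<close> of the arc length.\<close>
    define k where "k = 2 * t * r / pi"
    have k: "0 < k" using r t by (simp add: k_def)
    have I: "((\<lambda>b. r / (ln r + c) * exp (- (k * b))) has_integral
        (- (r / (ln r + c) / k * exp (- (k * (pi / 2)))) - (- (r / (ln r + c) / k * exp (- (k * 0)))))) {0..pi/2}"
      using k r by (intro fundamental_theorem_of_calculus)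
         (auto intro!: derivative_eq_intros simp: has_real_derivative_iff_has_vector_derivative[symmetric])
    have "cmod (P (of_real (ln r) + \<i> * of_real (pi / 2)) - P (of_real (ln r)))
       = cmod (integral {0..pi/2} (\<lambda>b. \<i> * h (of_real (ln r) + \<i> * of_real b)))"
      by (simp only: integral_unique[OF arc])
    also have "\<dots> \<le> integral {0..pi/2} (\<lambda>b. r / (ln r + c) * exp (- (k * b)))"
    proof (rule integral_norm_bound_integral)
      fix b assume "b \<in> {0..pi / 2}"
      then have b: "0 \<le> b" "b \<le> pi / 2" by auto
      have "r * exp (- (t * r * sin b)) / cmod (of_real (ln r + c) + \<i> * of_real (b + pi / 2))
        \<le> r * exp (- (k * b)) / (ln r + c)"
      proof (rule frac_le)
        have "k * b \<le> t * r * sin b"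
          using mult_left_mono[OF jordan_sin_ge[OF b], of "t * r"] r t by (simp add: k_def mult_ac)
        then show "r * exp (- (t * r * sin b)) \<le> r * exp (- (k * b))" using r by simp
        show "ln r + c \<le> cmod (of_real (ln r + c) + \<i> * of_real (b + pi / 2))"
          using cmod_add_real_ge[of "ln r + c" "b + pi / 2"] r by linarith
      qed (use r in auto)
      then show "cmod (\<i> * h (of_real (ln r) + \<i> * of_real b)) \<le> r / (ln r + c) * exp (- (k * b))"
        unfolding arc_norm[OF r(1)] by simp
    qed (use arc I in \<open>auto simp: has_integral_iff\<close>)
    also have "\<dots> = r / (ln r + c) / k - r / (ln r + c) / k * exp (- (k * (pi / 2)))"
      unfolding integral_unique[OF I] by simp
    also have "\<dots> \<le> r / (ln r + c) / k" using r k by simp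
    also have "r / L / k = pi / (2 * t) / L" for L
      using r t by (simp add: k_def divide_simps)
    finally show "cmod (P (of_real (ln r) + \<i> * of_real (pi / 2)) - P (of_real (ln r))) \<le> pi / (2 * t) / (ln r + c)" .
  qed
qed

text \<open>The rotation is carried out on a quarter annulus whose inner radius \<open>d\<close> is
  made arbitrarily small. The inner arc and the pieces over \<open>[0,d]\<close> are
  \<open>O(d)\<close>, so only the outer arc contributes to the bound.\<close>

lemma rotate_to_cut:
  assumes t: "0 < t" and R: "0 < R" "0 < ln R + c"
  shows "cmod (integral {0..R} (on_imag c t) - integral {0..R} (on_cut c t)) \<le> pi / (2 * t) / (ln R + c)"
proof -
  obtain P where P:
    "\<And>e R. 0 < e \<Longrightarrow> e \<le> R \<Longrightarrow>
       (on_imag c t has_integral P (of_real (ln R)) - P (of_real (ln e))) {e..R}"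
    "\<And>e R. 0 < e \<Longrightarrow> e \<le> R \<Longrightarrow> (on_cut c t has_integral
       P (of_real (ln R) + \<i> * of_real (pi / 2)) - P (of_real (ln e) + \<i> * of_real (pi / 2))) {e..R}"
    "\<And>r. 0 < r \<Longrightarrow> cmod (P (of_real (ln r) + \<i> * of_real (pi / 2)) - P (of_real (ln r))) \<le> r"
    "\<And>r. 0 < r \<Longrightarrow> 0 < ln r + c \<Longrightarrow>
       cmod (P (of_real (ln r) + \<i> * of_real (pi / 2)) - P (of_real (ln r))) \<le> pi / (2 * t) / (ln r + c)"
    using quarter_turn[OF t, of c] by blast
  have close: "cmod (integral {0..R} (on_imag c t) - integral {0..R} (on_cut c t))
      \<le> pi / (2 * t) / (ln R + c) + e" if e: "0 < e" for e
  proof -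
    \<comment> \<open>The contributions near \<open>0\<close> add up to \<open>(3/pi + 1) d\<close>,
      which is at most \<open>2 d \<le> e\<close> because \<open>pi > 3\<close>.\<close>
    define d where "d = min R (e / 2)"
    have d: "0 < d" "d \<le> R" "d \<le> e / 2" using e R by (auto simp: d_def)
    define D where "D r = P (of_real (ln r) + \<i> * of_real (pi / 2)) - P (of_real (ln r))" for r
    have 1: "integral {0..R} (on_imag c t) = integral {0..d} (on_imag c t) + (P (of_real (ln R)) - P (of_real (ln d)))"
      using Henstock_Kurzweil_Integration.integral_combine[of 0 d R "on_imag c t"] d on_imag_integrable P(1)[OF d(1,2)]
      by (simp add: integral_unique)
    have 2: "integral {0..R} (on_cut c t) = integral {0..d} (on_cut c t) +
       (P (of_real (ln R) + \<i> * of_real (pi / 2)) - P (of_real (ln d) + \<i> * of_real (pi / 2)))"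
      using Henstock_Kurzweil_Integration.integral_combine[of 0 d R "on_cut c t"] d on_cut_integrable[OF t] P(2)[OF d(1,2)]
      by (simp add: integral_unique)
    have 3: "cmod (integral {0..d} (on_imag c t)) \<le> 2 / pi * d"
      using integrable_bound[of "2 / pi" "on_imag c t" 0 d] on_imag_integrable on_imag_le d by (simp add: cbox_interval)
    have 4: "cmod (integral {0..d} (on_cut c t)) \<le> 1 / pi * d"
    proof -
      have "cmod (on_cut c t y) \<le> 1 / pi" if "0 \<le> y" for y
      proof -
        have "cmod (on_cut c t y) \<le> exp (- (t * y)) / pi" using that t by (intro on_cut_le) auto
        also have "\<dots> \<le> 1 / pi" using that t by (intro divide_right_mono) auto
        finally show ?thesis .
      qed
      then show ?thesis
        using integrable_bound[of "1 / pi" "on_cut c t" 0 d] on_cut_integrable[OF t] d by (simp add: cbox_interval)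
    qed
    have "integral {0..R} (on_imag c t) - integral {0..R} (on_cut c t) =
        integral {0..d} (on_imag c t) - integral {0..d} (on_cut c t) + (D d - D R)"
      unfolding 1 2 D_def by simp
    also have "cmod \<dots> \<le> 2 / pi * d + 1 / pi * d + (d + pi / (2 * t) / (ln R + c))"
      using P(3)[OF d(1)] P(4)[OF R] 3 4 unfolding D_def[symmetric]
      by (intro order_trans[OF norm_triangle_ineq] order_trans[OF norm_triangle_ineq4] add_mono)
    also have "2 / pi * d + 1 / pi * d = 3 / pi * d" by (simp add: field_simps)
    also have "3 / pi * d \<le> 1 * d" using pi_gt3 d by (intro mult_right_mono) auto
    finally show ?thesis using d by simp
  qed
  show ?thesis by (rule field_le_epsilon) (use close in blast)
qed

text \<open>Proportional to the jump of \<open>1 / (log z + c)\<close> across the negative real axis.\<close>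

definition log_density :: "real \<Rightarrow> real \<Rightarrow> real" where
  "log_density c y = 1 / ((ln y + c)\<^sup>2 + pi\<^sup>2)"

lemma log_density_nonneg: "0 \<le> log_density c y" by (simp add: log_density_def)

lemma log_density_le: "log_density c y \<le> 1 / pi\<^sup>2"
  unfolding log_density_def by (intro divide_left_mono) (auto simp: add_nonneg_pos)

lemma log_density_measurable [measurable]: "log_density c \<in> borel_measurable borel"
  unfolding log_density_def by measurable

lemma Re_on_cut: "Re (on_cut c t y) = pi * (exp (- (t * y)) * log_density c y)"
proof -
  have "exp (- complex_of_real (t * y)) = of_real (exp (- (t * y)))"
    by (simp add: exp_of_real[symmetric])
  then show ?thesis
    unfolding on_cut_def log_density_def by (simp add: Re_divide power2_eq_square)
qed

section \<open>The kernel as a Laplace transform of the log density\<close>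

lemma exp_decay_integrable:
  fixes t :: real
  assumes "0 < t" shows "integrable lborel (\<lambda>x. exp (- (t * x)) * indicator {0..} x)"
proof -
  have "(\<integral>\<^sup>+x. ennreal (exp (- (t * x))) * indicator {0..} x \<partial>lborel) = ennreal (0 - (- (exp (- (t * 0)) / t)))"
  proof (rule nn_integral_FTC_atLeast)
    show "((\<lambda>x. - (exp (- (t * x)) / t)) \<longlongrightarrow> 0) at_top" using assms by real_asymp
  qed (use assms in \<open>auto intro!: derivative_eq_intros\<close>)
  then show ?thesis
    by (intro integrableI_nn_integral_finite[where x = "1 / t"])
       (use assms in \<open>auto simp: ennreal_mult' ennreal_indicator\<close>)
qed

lemma exp_log_density_set_integrable:
  assumes "0 < t" shows "set_integrable lborel {0..} (\<lambda>y. exp (- (t * y)) * log_density c y)"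
  unfolding set_integrable_def
proof (rule Bochner_Integration.integrable_bound)
  show "integrable lborel (\<lambda>x. 1 / pi\<^sup>2 * (exp (- (t * x)) * indicator {0..} x))"
    using exp_decay_integrable[OF assms] by (rule integrable_mult_right)
  show "AE x in lborel. norm (indicat_real {0..} x *\<^sub>R (exp (- (t * x)) * log_density c x))
         \<le> norm (1 / pi\<^sup>2 * (exp (- (t * x)) * indicator {0..} x))"
    using log_density_le[of c] log_density_nonneg[of c] by (auto simp: indicator_def abs_mult field_simps)
qed measurable

lemma Ln_csqrt_imag:
  assumes "0 < y"
  shows "Ln (csqrt (\<i> * of_real y)) = of_real (ln y / 2) + \<i> * of_real (pi / 4)"
    and "Ln (csqrt (\<i> * of_real (- y))) = of_real (ln y / 2) - \<i> * of_real (pi / 4)"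
proof -
  have *: "Ln (\<i> * of_real y) = of_real (ln y) + \<i> * of_real (pi / 2)"
    "Ln (\<i> * of_real (- y)) = of_real (ln y) - \<i> * of_real (pi / 2)"
    using assms Ln_times_of_real[of y \<i>] Ln_times_of_real[of y "- \<i>"]
    by (auto simp: Ln_of_real mult.commute)
  have "csqrt (\<i> * of_real y) = exp (Ln (\<i> * of_real y) / 2)"
    "csqrt (\<i> * of_real (- y)) = exp (Ln (\<i> * of_real (- y)) / 2)"
    using assms by (auto intro!: csqrt_exp_Ln)
  moreover have "Ln (\<i> * of_real y) / 2 = of_real (ln y / 2) + \<i> * of_real (pi / 4)"
    "Ln (\<i> * of_real (- y)) / 2 = of_real (ln y / 2) - \<i> * of_real (pi / 4)"
    unfolding * by (auto simp: field_simps)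
  ultimately show "Ln (csqrt (\<i> * of_real y)) = of_real (ln y / 2) + \<i> * of_real (pi / 4)"
    "Ln (csqrt (\<i> * of_real (- y))) = of_real (ln y / 2) - \<i> * of_real (pi / 4)"
    \<comment> \<open>The heights \<open>pi/4\<close> and \<open>-pi/4\<close> lie in the principal
      strip, so \<open>Ln\<close> inverts the exponential there.\<close>
    by (simp only:, subst Ln_exp; simp; use pi_gt_zero in linarith)+
qed

text \<open>The two halves of the imaginary axis carry conjugate contributions, so each symmetric
  truncation is real and determined by \<open>Re\<close> of the upper half. Rotation moves this half
  to the cut, where the real part is absolutely integrable; the outer arc tends to \<open>0\<close>,
  which also shows that the limit defining \<open>Kth\<close> exists.\<close>

lemma Kth_eq:
  assumes t: "0 < t"
  shows "Kth \<theta> t = of_real (2 * (LINT y:{0..}|lborel. exp (- (t * y)) * log_density (2 * kappa \<theta>) y))"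
proof -
  define c where "c = 2 * kappa \<theta>"
  define F where "F y = exp (of_real t * (\<i> * of_real y)) *
        inverse (Ln (csqrt (\<i> * of_real y)) + of_real (kappa \<theta>)) * \<i>" for y :: real
  have Fpos: "F y = 2 * \<i> * on_imag c t y" if "0 < y" for y
  proof -
    have "of_real (ln y / 2) + \<i> * of_real (pi / 4) + of_real (kappa \<theta>) =
      (of_real (ln y + c) + \<i> * of_real (pi / 2)) / 2"
      by (simp add: c_def complex_eq_iff)
    then show ?thesis
      unfolding F_def Ln_csqrt_imag[OF that] on_imag_def by (simp add: field_simps)
  qed
  have Fneg: "F (- y) = 2 * \<i> * cnj (on_imag c t y)" if "0 < y" for y
  proof -
    have "of_real (ln y / 2) - \<i> * of_real (pi / 4) + of_real (kappa \<theta>) =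
      (of_real (ln y + c) - \<i> * of_real (pi / 2)) / 2"
      by (simp add: c_def complex_eq_iff)
    then show ?thesis
      unfolding F_def Ln_csqrt_imag[OF that] on_imag_def
      by (simp add: field_simps exp_cnj)
  qed
  have trunc: "(1 / (2 * of_real pi * \<i>)) * integral {-R..R} F = of_real (2 / pi * Re (integral {0..R} (on_imag c t)))"
    if R: "0 < R" for R
  proof -
    define A where "A = integral {0..R} (on_imag c t)"
    have A: "(on_imag c t has_integral A) {0..R}"
      unfolding A_def using on_imag_integrable by (rule integrable_integral)
    have "((\<lambda>y. 2 * \<i> * on_imag c t y) has_integral 2 * \<i> * A) {0..R}"
      using A by (rule has_integral_mult_right)
    \<comment> \<open>The formula for \<open>F\<close> holds only for \<open>y > 0\<close>; the
      single point \<open>0\<close> is negligible.\<close>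
    then have p: "(F has_integral 2 * \<i> * A) {0..R}"
      by (rule has_integral_spike[rotated 2, where S = "{0}"]) (auto simp: Fpos)
    have "((\<lambda>y. 2 * \<i> * cnj (on_imag c t y)) has_integral 2 * \<i> * cnj A) {0..R}"
      using A has_integral_cnj[of "on_imag c t" A] by (intro has_integral_mult_right) (auto simp: o_def)
    then have "((\<lambda>y. F (- y)) has_integral 2 * \<i> * cnj A) {0..R}"
      by (rule has_integral_spike[rotated 2, where S = "{0}"]) (auto simp: Fneg)
    then have n: "(F has_integral 2 * \<i> * cnj A) {-R..0}"
      using has_integral_reflect_real[where f = F and a = "- R" and b = 0] by simp
    have "(F has_integral (2 * \<i> * cnj A + 2 * \<i> * A)) {-R..R}"
      using n p R by (intro has_integral_combine[of "-R" 0 R]) auto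
    then have "integral {-R..R} F = 2 * \<i> * (A + cnj A)"
      by (simp add: integral_unique algebra_simps)
    also have "\<dots> = 2 * \<i> * of_real (2 * Re A)"
      by (simp only: complex_add_cnj)
    finally show ?thesis
      unfolding A_def[symmetric] by (simp add: field_simps)
  qed
  have lim_cut: "((\<lambda>R. 2 / pi * Re (integral {0..R} (on_cut c t))) \<longlongrightarrow>
     2 * (LINT y:{0..}|lborel. exp (- (t * y)) * log_density c y)) at_top"
  proof -
    have "2 / pi * Re (integral {0..R} (on_cut c t)) = 2 * (LINT y:{0..R}|lborel. exp (- (t * y)) * log_density c y)" for R
    proof -
      have "Re (integral {0..R} (on_cut c t)) = integral {0..R} (\<lambda>y. Re (on_cut c t y))"
        using integral_linear[OF on_cut_integrable[OF t order_refl] bounded_linear_Re] by (simp add: o_def)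
      also have "\<dots> = pi * integral {0..R} (\<lambda>y. exp (- (t * y)) * log_density c y)"
        unfolding Re_on_cut by simp
      also have "integral {0..R} (\<lambda>y. exp (- (t * y)) * log_density c y) = (LINT y:{0..R}|lborel. exp (- (t * y)) * log_density c y)"
        by (rule set_borel_integral_eq_integral(2)[symmetric],
            rule set_integrable_subset[OF exp_log_density_set_integrable[OF t]]) auto
      finally show ?thesis by simp
    qed
    moreover have "((\<lambda>R. LINT y:{0..R}|lborel. exp (- (t * y)) * log_density c y) \<longlongrightarrow>
       (LINT y:{0..}|lborel. exp (- (t * y)) * log_density c y)) at_top"
      by (rule tendsto_set_lebesgue_integral_at_top[OF _ exp_log_density_set_integrable[OF t]]) auto
    ultimately show ?thesis by (simp add: tendsto_mult_left)
  qed
  have "((\<lambda>R. 2 / pi * Re (integral {0..R} (on_imag c t)) - 2 / pi * Re (integral {0..R} (on_cut c t))) \<longlongrightarrow> 0) at_top"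
  proof (rule Lim_null_comparison)
    have ev: "eventually (\<lambda>R. 0 < ln R + c) at_top" 
      by real_asymp
    show "eventually (\<lambda>R. norm (2 / pi * Re (integral {0..R} (on_imag c t)) - 2 / pi * Re (integral {0..R} (on_cut c t)))
        \<le> 2 / pi * (pi / (2 * t) / (ln R + c))) at_top"
      using ev eventually_gt_at_top[of 0]
    proof eventually_elim
      case (elim R)
      have "norm (2 / pi * Re (integral {0..R} (on_imag c t)) - 2 / pi * Re (integral {0..R} (on_cut c t)))
        = 2 / pi * \<bar>Re (integral {0..R} (on_imag c t) - integral {0..R} (on_cut c t))\<bar>"
        by (simp add: abs_mult right_diff_distrib[symmetric] del: times_divide_eq_left)
      also have "\<dots> \<le> 2 / pi * (pi / (2 * t) / (ln R + c))"
        using rotate_to_cut[OF t elim(2,1)] abs_Re_le_cmod order_trans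
        by (intro mult_left_mono) (blast, simp)
      finally show ?case .
    qed
    show "((\<lambda>R. 2 / pi * (pi / (2 * t) / (ln R + c))) \<longlongrightarrow> 0) at_top"
      using t by real_asymp
  qed
  from tendsto_add[OF this lim_cut]
  have "((\<lambda>R. complex_of_real (2 / pi * Re (integral {0..R} (on_imag c t)))) \<longlongrightarrow>
      of_real (2 * (LINT y:{0..}|lborel. exp (- (t * y)) * log_density c y))) at_top"
    by (intro tendsto_of_real) simp
  then have "((\<lambda>R. (1 / (2 * of_real pi * \<i>)) * integral {-R..R} F) \<longlongrightarrow>
      of_real (2 * (LINT y:{0..}|lborel. exp (- (t * y)) * log_density c y))) at_top"
    by (rule Lim_transform_eventually)
       (use eventually_gt_at_top[of 0] in \<open>eventually_elim, simp only: trunc\<close>)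
  then show ?thesis
    unfolding Kth_def c_def[symmetric] F_def by (intro tendsto_Lim) auto
qed

section \<open>The running integral of the kernel\<close>

text \<open>The decay is only that of \<open>1 / (y (ln y)^2)\<close>, but there is an explicit
  antiderivative, \<open>arctan ((ln y + c) / pi) / pi\<close>, with the finite limit
  \<open>1/2\<close>.\<close>

lemma log_density_over_y_integrable: "set_integrable lborel {1..} (\<lambda>y. log_density c y / y)"
proof -
  have "(\<integral>\<^sup>+y. ennreal (log_density c y / y) * indicator {1..} y \<partial>lborel) = ennreal (1 / 2 - arctan ((ln 1 + c) / pi) / pi)"
  proof (rule nn_integral_FTC_atLeast)
    show "((\<lambda>y. arctan ((ln y + c) / pi) / pi) \<longlongrightarrow> 1 / 2) at_top"
    proof -
      have "((\<lambda>y. arctan ((ln y + c) / pi)) \<longlongrightarrow> pi / 2) at_top"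
        by (rule filterlim_compose[OF tendsto_arctan_at_top])
           (use pi_gt_zero in real_asymp)
      from tendsto_divide[OF this tendsto_const[of pi]] show ?thesis by simp
    qed
    fix y :: real assume y: "1 \<le> y"
    have "((\<lambda>y. arctan ((ln y + c) / pi) / pi) has_real_derivative
       (1 / y / pi) / (1 + ((ln y + c) / pi)\<^sup>2) / pi) (at y)"
      using y by (auto intro!: derivative_eq_intros simp: divide_simps)
    also have "(1 / y / pi) / (1 + ((ln y + c) / pi)\<^sup>2) / pi = log_density c y / y"
    proof -
      have "(1 / y / pi) / (1 + ((ln y + c) / pi)\<^sup>2) / pi = 1 / (y * (pi\<^sup>2 * (1 + ((ln y + c) / pi)\<^sup>2)))"
        by (simp add: power2_eq_square mult_ac)
      also have "pi\<^sup>2 * (1 + ((ln y + c) / pi)\<^sup>2) = (ln y + c)\<^sup>2 + pi\<^sup>2"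
        by (simp add: power_divide algebra_simps)
      finally show ?thesis by (simp add: log_density_def mult.commute)
    qed
    finally show "((\<lambda>y. arctan ((ln y + c) / pi) / pi) has_real_derivative log_density c y / y) (at y)" .
    show "0 \<le> log_density c y / y" using y log_density_nonneg by simp
  qed measurable
  also have "(\<integral>\<^sup>+y. ennreal (log_density c y / y) * indicator {1..} y \<partial>lborel)
      = (\<integral>\<^sup>+y. ennreal (indicator {1..} y * (log_density c y / y)) \<partial>lborel)"
    by (intro nn_integral_cong) (simp add: indicator_def)
  finally have "integrable lborel (\<lambda>y. indicator {1..} y * (log_density c y / y))"
    using arctan_ubound[of "(ln 1 + c) / pi"] log_density_nonneg[of c]
    by (intro integrableI_nn_integral_finite) (auto simp: field_simps indicator_def)
  then show ?thesis by (simp add: set_integrable_def)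
qed

text \<open>The integral of this over \<open>y > 0\<close> is half the integral of \<open>K\<close> over \<open>(0,t)\<close>.\<close>

definition cum_density :: "real \<Rightarrow> real \<Rightarrow> real \<Rightarrow> real" where
  "cum_density c t y = log_density c y * ((1 - exp (- (t * y))) / y)"

lemma cum_density_measurable [measurable]: "cum_density c t \<in> borel_measurable borel"
  unfolding cum_density_def by measurable

lemma cum_density_nonneg:
  assumes "0 \<le> t" "0 \<le> y" shows "0 \<le> cum_density c t y"
  unfolding cum_density_def using assms log_density_nonneg by (intro mult_nonneg_nonneg divide_nonneg_nonneg) auto

lemma set_integrable_bounded:
  fixes f :: "real \<Rightarrow> real"
  assumes "f \<in> borel_measurable borel" "\<And>y. 0 < y \<Longrightarrow> y < 1 \<Longrightarrow> \<bar>f y\<bar> \<le> B"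
  shows "set_integrable lborel {0<..<1} f"
  unfolding set_integrable_def
proof (rule Bochner_Integration.integrable_bound)
  show "integrable lborel (\<lambda>y. \<bar>B\<bar> * indicator {0<..<1::real} y)"
    by (intro integrable_mult_right integrable_real_indicator) auto
  show "AE y in lborel. norm (indicat_real {0<..<1} y *\<^sub>R f y) \<le> norm (\<bar>B\<bar> * indicator {0<..<1} y)"
    using order_trans[OF assms(2) abs_ge_self] by (intro AE_I2) (auto simp: indicator_def)
qed (use assms(1) in measurable)

text \<open>Near \<open>0\<close> the inequality \<open>1 - exp (- t y) \<le> t y\<close> cancels
  the factor \<open>1/y\<close>.\<close>

lemma cum_density_integrable_unit:
  assumes "0 \<le> t" shows "set_integrable lborel {0<..<1} (cum_density c t)"
proof (rule set_integrable_bounded)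
  fix y :: real assume y: "0 < y" "y < 1"
  have "1 - exp (- (t * y)) \<le> t * y" using exp_ge_add_one_self[of "- (t * y)"] by simp
  then have "(1 - exp (- (t * y))) / y \<le> t" using y by (simp add: field_simps)
  then have "cum_density c t y \<le> 1 / pi\<^sup>2 * t"
    unfolding cum_density_def using y assms log_density_le log_density_nonneg by (intro mult_mono) auto
  then show "\<bar>cum_density c t y\<bar> \<le> 1 / pi\<^sup>2 * t" using cum_density_nonneg[of t y c] y assms by simp
qed measurable

lemma exp_log_density_over_y_integrable:
  assumes "0 \<le> t" shows "set_integrable lborel {1..} (\<lambda>y. exp (- (t * y)) * (log_density c y / y))"
  using log_density_over_y_integrable[of c] unfolding set_integrable_def
proof (rule Bochner_Integration.integrable_bound)
  show "AE y in lborel. norm (indicat_real {1..} y *\<^sub>R (exp (- (t * y)) * (log_density c y / y)))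
    \<le> norm (indicat_real {1..} y *\<^sub>R (log_density c y / y))"
    using assms log_density_nonneg[of c]
    by (intro AE_I2) (auto simp: indicator_def abs_mult intro!: mult_left_le_one_le divide_right_mono)
qed measurable

text \<open>On \<open>[1,\<infinity>)\<close> the terms \<open>1\<close> and
  \<open>exp (- t y)\<close> are integrable separately against \<open>log_density c y / y\<close>.
  The part over \<open>(0,1)\<close> is kept whole for the Taylor expansion.\<close>

lemma cum_density_integral:
  assumes t: "0 \<le> t"
  shows "set_integrable lborel {0<..} (cum_density c t)"
    and "(LINT y:{0<..}|lborel. cum_density c t y) = (LINT y:{0<..<1}|lborel. cum_density c t y)
       + (LINT y:{1..}|lborel. log_density c y / y) - (LINT y:{1..}|lborel. exp (- (t * y)) * (log_density c y / y))"
proof -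
  have eq: "cum_density c t = (\<lambda>y. log_density c y / y - exp (- (t * y)) * (log_density c y / y))"
    by (rule ext) (simp add: cum_density_def field_simps diff_divide_distrib)
  have 1: "set_integrable lborel {1..} (cum_density c t)"
    unfolding eq by (rule set_integral_diff(1)[OF log_density_over_y_integrable exp_log_density_over_y_integrable[OF t]])
  have 2: "(LINT y:{1..}|lborel. cum_density c t y) =
     (LINT y:{1..}|lborel. log_density c y / y) - (LINT y:{1..}|lborel. exp (- (t * y)) * (log_density c y / y))"
    unfolding eq by (rule set_integral_diff(2)[OF log_density_over_y_integrable exp_log_density_over_y_integrable[OF t]])
  have U: "{0<..} = {0<..<1} \<union> {1::real..}" by auto
  show "set_integrable lborel {0<..} (cum_density c t)"
    unfolding U by (rule set_integrable_Un[OF cum_density_integrable_unit[OF t] 1]) auto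
  show "(LINT y:{0<..}|lborel. cum_density c t y) = (LINT y:{0<..<1}|lborel. cum_density c t y)
       + (LINT y:{1..}|lborel. log_density c y / y) - (LINT y:{1..}|lborel. exp (- (t * y)) * (log_density c y / y))"
    unfolding U using set_integral_Un[OF _ cum_density_integrable_unit[OF t] 1] 2
    by (simp add: Int_def del: times_divide_eq_right)
qed

text \<open>Both factors of the convolution are cut off at nonpositive times, so that all integrals
  run over the whole line and the limits of integration come for free.\<close>

definition Kpos :: "real \<Rightarrow> real \<Rightarrow> real" where
  "Kpos c u = (if 0 < u then 2 * (LINT y:{0..}|lborel. exp (- (u * y)) * log_density c y) else 0)"

definition NEpos :: "real \<Rightarrow> real \<Rightarrow> real" where
  "NEpos x r = (if 0 < r then NE x r else 0)"

text \<open>Stated for composed arguments, so that measurability of the iterated integrands in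
  several variables is found automatically.\<close>

lemma NEpos_measurable [measurable (raw)]:
  assumes [measurable]: "f \<in> borel_measurable M" "g \<in> borel_measurable M"
  shows "(\<lambda>w. NEpos (f w) (g w)) \<in> borel_measurable M"
  unfolding NEpos_def NE_def by measurable

lemma Kpos_measurable [measurable]: "Kpos c \<in> borel_measurable borel"
proof -
  have "(\<lambda>u. LINT y|lborel. indicat_real {0..} y *\<^sub>R (exp (- (u * y)) * log_density c y)) \<in> borel_measurable borel"
    by measurable
  then show ?thesis unfolding Kpos_def set_lebesgue_integral_def by measurable
qed

lemma Kpos_nonneg: "0 \<le> Kpos c u"
  unfolding Kpos_def set_lebesgue_integral_def using log_density_nonneg
  by (auto intro!: integral_nonneg_AE)

lemma NEpos_nonneg: "0 \<le> x \<Longrightarrow> 0 \<le> NEpos x r"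
  by (simp add: NEpos_def NE_def)

text \<open>The Gaussian factor beats \<open>1/r\<close>: with \<open>q = x^2 / (4 r)\<close>,
  \<open>exp (- q) \<le> 1 / q\<close>. At \<open>x = 0\<close> both the kernel and the bound are
  \<open>0\<close>. The bound is not uniform as \<open>x\<close> tends to \<open>0\<close>.\<close>

lemma NEpos_bounded:
  assumes "0 \<le> x" obtains M where "0 \<le> M" "\<And>r. NEpos x r \<le> M"
proof
  show "0 \<le> 2 * sqrt x / x\<^sup>2" using assms by simp
  show "NEpos x r \<le> 2 * sqrt x / x\<^sup>2" for r
  proof (cases "0 < r \<and> 0 < x")
    case True
    have "x\<^sup>2 / (4 * r) < exp (x\<^sup>2 / (4 * r))"
      using exp_ge_add_one_self[of "x\<^sup>2 / (4 * r)"] by linarith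
    then have "exp (- (x\<^sup>2 / (4 * r))) \<le> 1 / (x\<^sup>2 / (4 * r))"
      unfolding exp_minus inverse_eq_divide using True by (intro divide_left_mono) auto
    then have "sqrt x / (2 * r) * exp (- (x\<^sup>2 / (4 * r))) \<le> sqrt x / (2 * r) * (1 / (x\<^sup>2 / (4 * r)))"
      using True by (intro mult_left_mono) auto
    also have "\<dots> = 2 * sqrt x / x\<^sup>2" using True by (simp add: field_simps)
    finally show ?thesis using True by (simp add: NEpos_def NE_def)
  qed (use assms in \<open>auto simp: NEpos_def NE_def\<close>)
qed

section \<open>Mass of the kernel on \<open>(0,t)\<close>\<close>

definition Kpos_mass :: "real \<Rightarrow> real \<Rightarrow> ennreal" where
  "Kpos_mass c t = (\<integral>\<^sup>+u. ennreal (Kpos c u) * indicator {..<t} u \<partial>lborel)"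

lemma Kpos_mass_mono: "s \<le> t \<Longrightarrow> Kpos_mass c s \<le> Kpos_mass c t"
  unfolding Kpos_mass_def by (intro nn_integral_mono) (auto simp: indicator_def)

lemma ennreal_Kpos:
  assumes "0 < u"
  shows "ennreal (Kpos c u) = (\<integral>\<^sup>+y. ennreal (2 * exp (- (u * y)) * log_density c y) * indicator {0..} y \<partial>lborel)"
proof -
  have "(\<integral>\<^sup>+y. ennreal (indicator {0..} y *\<^sub>R (exp (- (u * y)) * log_density c y)) \<partial>lborel)
      = ennreal (LINT y:{0..}|lborel. exp (- (u * y)) * log_density c y)"
    unfolding set_lebesgue_integral_def
    using exp_log_density_set_integrable[OF assms, of c] log_density_nonneg unfolding set_integrable_def
    by (intro nn_integral_eq_integral) auto
  moreover have "(\<integral>\<^sup>+y. ennreal (2 * exp (- (u * y)) * log_density c y) * indicator {0..} y \<partial>lborel) =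
     (\<integral>\<^sup>+y. 2 * ennreal (indicator {0..} y *\<^sub>R (exp (- (u * y)) * log_density c y)) \<partial>lborel)"
    by (intro nn_integral_cong) (auto simp: indicator_def ennreal_mult' mult.assoc log_density_nonneg)
  ultimately show ?thesis
    using assms by (simp add: nn_integral_cmult Kpos_def ennreal_mult')
qed

text \<open>By Tonelli the time integral goes inside, and integrating \<open>exp (- u y)\<close>
  over \<open>u\<close> in \<open>(0,t)\<close> gives \<open>(1 - exp (- t y)) / y\<close>.\<close>

lemma Kpos_mass_eq:
  assumes t: "0 < t"
  shows "Kpos_mass c t = ennreal (2 * (LINT y:{0<..}|lborel. cum_density c t y))"
proof -
  have "Kpos_mass c t = (\<integral>\<^sup>+u. (\<integral>\<^sup>+y. ennreal (2 * exp (- (u * y)) * log_density c y) *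
      indicator {0<..} y * indicator {0..t} u \<partial>lborel) \<partial>lborel)"
    unfolding Kpos_mass_def
  proof (rule nn_integral_cong_AE)
    show "AE u in lborel. ennreal (Kpos c u) * indicator {..<t} u =
      (\<integral>\<^sup>+y. ennreal (2 * exp (- (u * y)) * log_density c y) * indicator {0<..} y * indicator {0..t} u \<partial>lborel)"
      using AE_lborel_singleton[of 0] AE_lborel_singleton[of t]
    proof eventually_elim
      case (elim u)
      consider "u < 0" | "0 < u" "u < t" | "t < u" using elim by linarith
      then show ?case
      proof cases
        case 2
        have "ennreal (Kpos c u) = (\<integral>\<^sup>+y. ennreal (2 * exp (- (u * y)) * log_density c y) * indicator {0<..} y \<partial>lborel)"
          unfolding ennreal_Kpos[OF 2(1)]
          by (intro nn_integral_cong_AE, use AE_lborel_singleton[of 0] in eventually_elim)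
             (auto simp: indicator_def)
        then show ?thesis using 2 by (simp add: indicator_def)
      qed (use t in \<open>auto simp: Kpos_def indicator_def\<close>)
    qed
  qed
  also have "\<dots> = (\<integral>\<^sup>+y. (\<integral>\<^sup>+u. ennreal (2 * exp (- (u * y)) * log_density c y) *
      indicator {0<..} y * indicator {0..t} u \<partial>lborel) \<partial>lborel)"
    by (rule lborel_pair.Fubini'[symmetric]) measurable
  also have "\<dots> = (\<integral>\<^sup>+y. ennreal (2 * (indicator {0<..} y *\<^sub>R cum_density c t y)) \<partial>lborel)"
  proof (rule nn_integral_cong)
    fix y :: real
    show "(\<integral>\<^sup>+u. ennreal (2 * exp (- (u * y)) * log_density c y) * indicator {0<..} y * indicator {0..t} u \<partial>lborel)
       = ennreal (2 * (indicator {0<..} y *\<^sub>R cum_density c t y))"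
    proof (cases "0 < y")
      case True
      have "(\<integral>\<^sup>+u. ennreal (2 * exp (- (u * y)) * log_density c y) * indicator {0..t} u \<partial>lborel)
         = ennreal (- (2 * exp (- (t * y)) * log_density c y / y) - (- (2 * exp (- (0 * y)) * log_density c y / y)))"
        using True t log_density_nonneg by (intro nn_integral_FTC_Icc) (auto intro!: derivative_eq_intros)
      also have "- (2 * exp (- (t * y)) * log_density c y / y) - (- (2 * exp (- (0 * y)) * log_density c y / y)) = 2 * cum_density c t y"
        using True by (simp add: cum_density_def field_simps)
      finally show ?thesis using True by (simp add: mult_ac)
    qed simp
  qed
  also have "\<dots> = ennreal (LINT y|lborel. 2 * (indicator {0<..} y *\<^sub>R cum_density c t y))"
    using cum_density_integral(1)[of t c] t cum_density_nonneg[of t _ c] unfolding set_integrable_def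
    by (intro nn_integral_eq_integral) (auto simp: indicator_def intro!: integrable_mult_right)
  also have "\<dots> = ennreal (2 * (LINT y:{0<..}|lborel. cum_density c t y))"
    unfolding set_lebesgue_integral_def by simp
  finally show ?thesis .
qed

section \<open>The trace as a convolution\<close>

text \<open>For \<open>u < t\<close> this is the function \<open>G\<close> of the overview at
  \<open>t - u\<close>. The \<open>x\<close>-integral is innermost because it has a closed
  form.\<close>

definition NE_overlap :: "real \<Rightarrow> real \<Rightarrow> ennreal" where
  "NE_overlap t u = (\<integral>\<^sup>+s. \<integral>\<^sup>+x. ennreal (NEpos x (t - s) * NEpos x (s - u)) * indicator {0..1} x \<partial>lborel \<partial>lborel)"

text \<open>The product of the two heat-type kernels has the explicit \<open>x\<close>-antiderivative
  \<open>- exp (- x\<^sup>2 a / (4 \<alpha> \<beta>)) / (2 a)\<close> with \<open>a = \<alpha> + \<beta>\<close>.\<close>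

lemma NEpos_product_integral:
  assumes "0 < \<alpha>" "0 < \<beta>"
  defines "a \<equiv> \<alpha> + \<beta>"
  shows "(\<integral>\<^sup>+x. ennreal (NEpos x \<alpha> * NEpos x \<beta>) * indicator {0..1} x \<partial>lborel)
     = ennreal ((1 - exp (- (a / (4 * \<alpha> * \<beta>)))) / (2 * a))"
proof -
  have a: "0 < a" using assms by simp
  \<comment> \<open>The sum of \<open>1 / (4 \<alpha>)\<close> and \<open>1 / (4 \<beta>)\<close>,
    hence the coefficient of \<open>x^2\<close> when the two Gaussians are multiplied.\<close>
  define q where "q = a / (4 * \<alpha> * \<beta>)"
  have q: "0 < q" using assms a by (simp add: q_def)
  have eq: "NEpos x \<alpha> * NEpos x \<beta> = x / (4 * \<alpha> * \<beta>) * exp (- (q * x\<^sup>2))" if "0 \<le> x" for x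
  proof -
    have "exp (- x\<^sup>2 / (4 * \<alpha>)) * exp (- x\<^sup>2 / (4 * \<beta>)) = exp (- (q * x\<^sup>2))"
      unfolding mult_exp_exp q_def a_def using assms(1,2) by (simp add: field_simps)
    moreover have "sqrt x / (2 * \<alpha>) * (sqrt x / (2 * \<beta>)) = x / (4 * \<alpha> * \<beta>)"
      using that by simp
    ultimately show ?thesis using assms(1,2)
      unfolding NEpos_def NE_def by (simp add: mult_ac)
  qed
  have "(\<integral>\<^sup>+x. ennreal (NEpos x \<alpha> * NEpos x \<beta>) * indicator {0..1} x \<partial>lborel)
     = (\<integral>\<^sup>+x. ennreal (x / (4 * \<alpha> * \<beta>) * exp (- (q * x\<^sup>2))) * indicator {0..1} x \<partial>lborel)"
    by (intro nn_integral_cong) (auto simp: eq indicator_def)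
  also have "\<dots> = ennreal (- (exp (- (q * 1\<^sup>2)) / (2 * a)) - (- (exp (- (q * 0\<^sup>2)) / (2 * a))))"
  proof (rule nn_integral_FTC_Icc)
    fix x :: real
    have "2 * a / (4 * \<alpha> * \<beta>) = 2 * q" by (simp add: q_def)
    then show "((\<lambda>x. - (exp (- (q * x\<^sup>2)) / (2 * a))) has_real_derivative x / (4 * \<alpha> * \<beta>) * exp (- (q * x\<^sup>2))) (at x)"
      using a assms(1,2) by (auto intro!: derivative_eq_intros simp: q_def mult_ac)
  qed (use assms(1,2) in auto)
  also have "- (exp (- (q * 1\<^sup>2)) / (2 * a)) - (- (exp (- (q * 0\<^sup>2)) / (2 * a))) = (1 - exp (- q)) / (2 * a)"
    by (simp add: diff_divide_distrib)
  finally show ?thesis unfolding q_def .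
qed

text \<open>The closed form bounds the \<open>x\<close>-integral by \<open>1 / (2 a)\<close> above
  and by \<open>(1 - exp (- 1/t)) / (2 a)\<close> below, uniformly for \<open>s\<close> in
  \<open>(u,t)\<close>. That interval has length \<open>a\<close>, which cancels the
  \<open>a\<close> in the denominator.\<close>

lemma NE_overlap_bounds:
  assumes "0 < u" "u < t"
  shows "NE_overlap t u \<le> ennreal (1 / 2)" "ennreal ((1 - exp (- (1 / t))) / 2) \<le> NE_overlap t u"
proof -
  define a where "a = t - u"
  have a: "0 < a" "a \<le> t" using assms by (auto simp: a_def)
  define J where "J s = (\<integral>\<^sup>+x. ennreal (NEpos x (t - s) * NEpos x (s - u)) * indicator {0..1} x \<partial>lborel)" for s
  have J: "J s = ennreal ((1 - exp (- (a / (4 * (t - s) * (s - u))))) / (2 * a))" if "u < s" "s < t" for s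
    unfolding J_def using NEpos_product_integral[of "t - s" "s - u"] that by (simp add: a_def)
  have J0: "J s = 0" if "\<not> (u < s \<and> s < t)" for s
    unfolding J_def using that by (auto simp: NEpos_def)
  have up: "J s \<le> ennreal (1 / (2 * a)) * indicator {u<..<t} s" for s
  proof (cases "u < s \<and> s < t")
    case True
    then show ?thesis using J[of s] a by (auto intro!: ennreal_leI divide_right_mono)
  qed (simp add: J0)
  have low: "ennreal ((1 - exp (- (1 / t))) / (2 * a)) * indicator {u<..<t} s \<le> J s" for s
  proof (cases "u < s \<and> s < t")
    case True
    \<comment> \<open>The arithmetic-geometric mean inequality for \<open>t - s\<close> and
      \<open>s - u\<close>, whose sum is \<open>a\<close>: the exponent is smallest in modulus at
      the midpoint, with value \<open>1/a \<ge> 1/t\<close>.\<close>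
    have "0 \<le> ((t - s) - (s - u))\<^sup>2" by simp
    also have "\<dots> = a * a - 4 * (t - s) * (s - u)"
      unfolding a_def by (simp add: power2_eq_square algebra_simps)
    finally have "4 * (t - s) * (s - u) \<le> a * a" by simp
    then have "a / (a * a) \<le> a / (4 * (t - s) * (s - u))"
      using True a by (intro divide_left_mono) auto
    moreover have "1 / t \<le> a / (a * a)" using a by (auto intro!: divide_left_mono)
    ultimately have "1 / t \<le> a / (4 * (t - s) * (s - u))" by linarith
    then show ?thesis using True J[of s] a by (auto intro!: ennreal_leI divide_right_mono)
  qed simp
  have c: "(\<integral>\<^sup>+s. ennreal k * indicator {u<..<t} s \<partial>lborel) = ennreal (k * a)" if "0 \<le> k" for k
    using assms that by (simp add: nn_integral_cmult_indicator a_def ennreal_mult')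
  have "NE_overlap t u \<le> ennreal (1 / (2 * a) * a)"
    unfolding NE_overlap_def J_def[symmetric] using a by (subst c[symmetric]) (auto intro!: nn_integral_mono up)
  then show "NE_overlap t u \<le> ennreal (1 / 2)" using a by simp
  have "ennreal ((1 - exp (- (1 / t))) / (2 * a) * a) \<le> NE_overlap t u"
    unfolding NE_overlap_def J_def[symmetric] using a by (subst c[symmetric]) (auto intro!: nn_integral_mono low)
  then show "ennreal ((1 - exp (- (1 / t))) / 2) \<le> NE_overlap t u" using a by simp
qed

section \<open>The trace as an extended nonnegative integral\<close>

definition trace_nn :: "real \<Rightarrow> real \<Rightarrow> ennreal" where
  "trace_nn c t = (\<integral>\<^sup>+x. (\<integral>\<^sup>+s. (\<integral>\<^sup>+r. ennreal (NEpos x (t - s) * Kpos c (s - r) * NEpos x r)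
     \<partial>lborel) \<partial>lborel) * indicator {0..1} x \<partial>lborel)"

lemma trace_nn_eq: "trace_nn c t = (\<integral>\<^sup>+u. ennreal (Kpos c u) * NE_overlap t u \<partial>lborel)"
proof -
  define F where "F x s u = ennreal (NEpos x (t - s) * Kpos c u * NEpos x (s - u)) * indicator {0..1} x" for x s u
  have [measurable]: "(\<lambda>w. F (f w) (g w) (h w)) \<in> borel_measurable M"
    if [measurable]: "f \<in> borel_measurable M" "g \<in> borel_measurable M" "h \<in> borel_measurable M"
    for f g h and M :: "'z measure"
    unfolding F_def by measurable
  have "trace_nn c t = (\<integral>\<^sup>+x. \<integral>\<^sup>+s. \<integral>\<^sup>+u. F x s u \<partial>lborel \<partial>lborel \<partial>lborel)"
    unfolding trace_nn_def
  proof (rule nn_integral_cong)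
    fix x :: real
    \<comment> \<open>The substitution \<open>u = s - r\<close> makes the kernel depend on
      \<open>u\<close> alone.\<close>
    have "(\<integral>\<^sup>+r. ennreal (NEpos x (t - s) * Kpos c (s - r) * NEpos x r) \<partial>lborel) =
      (\<integral>\<^sup>+u. ennreal (NEpos x (t - s) * Kpos c u * NEpos x (s - u)) \<partial>lborel)" for s
      by (subst nn_integral_real_affine[where c = "- 1" and t = s]) auto
    then have "(\<integral>\<^sup>+s. \<integral>\<^sup>+r. ennreal (NEpos x (t - s) * Kpos c (s - r) * NEpos x r) \<partial>lborel \<partial>lborel) * indicator {0..1} x
       = (\<integral>\<^sup>+s. \<integral>\<^sup>+u. ennreal (NEpos x (t - s) * Kpos c u * NEpos x (s - u)) \<partial>lborel \<partial>lborel) * indicator {0..1} x"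
      by simp
    also have "\<dots> = (\<integral>\<^sup>+s. \<integral>\<^sup>+u. F x s u \<partial>lborel \<partial>lborel)"
      unfolding F_def by (simp add: indicator_def)
    finally show "(\<integral>\<^sup>+s. \<integral>\<^sup>+r. ennreal (NEpos x (t - s) * Kpos c (s - r) * NEpos x r) \<partial>lborel \<partial>lborel) * indicator {0..1} x
      = (\<integral>\<^sup>+s. \<integral>\<^sup>+u. F x s u \<partial>lborel \<partial>lborel)" .
  qed
  \<comment> \<open>Three exchanges of neighbouring variables carry the order \<open>x, s, u\<close>
    to \<open>u, s, x\<close>.\<close>
  also have "\<dots> = (\<integral>\<^sup>+x. \<integral>\<^sup>+u. \<integral>\<^sup>+s. F x s u \<partial>lborel \<partial>lborel \<partial>lborel)"
    by (intro nn_integral_cong lborel_pair.Fubini') measurable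
  also have "\<dots> = (\<integral>\<^sup>+u. \<integral>\<^sup>+x. \<integral>\<^sup>+s. F x s u \<partial>lborel \<partial>lborel \<partial>lborel)"
    by (intro lborel_pair.Fubini') measurable
  also have "\<dots> = (\<integral>\<^sup>+u. \<integral>\<^sup>+s. \<integral>\<^sup>+x. F x s u \<partial>lborel \<partial>lborel \<partial>lborel)"
    by (intro nn_integral_cong lborel_pair.Fubini') measurable
  also have "\<dots> = (\<integral>\<^sup>+u. ennreal (Kpos c u) * NE_overlap t u \<partial>lborel)"
  proof (rule nn_integral_cong)
    fix u
    have "F x s u = ennreal (Kpos c u) * (ennreal (NEpos x (t - s) * NEpos x (s - u)) * indicator {0..1} x)" for x s
      unfolding F_def using Kpos_nonneg[of c u] NEpos_nonneg[of x]
      by (auto simp: indicator_def ennreal_mult'[symmetric] mult_ac)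
    then show "(\<integral>\<^sup>+s. \<integral>\<^sup>+x. F x s u \<partial>lborel \<partial>lborel) = ennreal (Kpos c u) * NE_overlap t u"
      unfolding NE_overlap_def by (simp add: nn_integral_cmult)
  qed
  finally show ?thesis .
qed

lemma trace_nn_bounds:
  shows "trace_nn c t \<le> ennreal (1 / 2) * Kpos_mass c t" "ennreal ((1 - exp (- (1 / t))) / 2) * Kpos_mass c t \<le> trace_nn c t"
proof -
  have G0: "NE_overlap t u = 0" if "t \<le> u" for u
  proof -
    have "NEpos x (t - s) * NEpos x (s - u) = 0" for x s
      using that by (auto simp: NEpos_def)
    then show ?thesis unfolding NE_overlap_def by (simp only:) simp
  qed
  have "ennreal (Kpos c u) * NE_overlap t u \<le> ennreal (1 / 2) * (ennreal (Kpos c u) * indicator {..<t} u)" for u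
    using NE_overlap_bounds(1)[of u t] G0[of u]
    by (cases "0 < u"; cases "u < t") (auto simp: Kpos_def mult.commute intro!: mult_right_mono)
  then show "trace_nn c t \<le> ennreal (1 / 2) * Kpos_mass c t"
    unfolding trace_nn_eq Kpos_mass_def by (subst nn_integral_cmult[symmetric]) (auto intro!: nn_integral_mono)
  have "ennreal ((1 - exp (- (1 / t))) / 2) * (ennreal (Kpos c u) * indicator {..<t} u) \<le> ennreal (Kpos c u) * NE_overlap t u" for u
    using NE_overlap_bounds(2)[of u t]
    by (cases "0 < u"; cases "u < t") (auto simp: Kpos_def mult.commute intro!: mult_right_mono)
  then show "ennreal ((1 - exp (- (1 / t))) / 2) * Kpos_mass c t \<le> trace_nn c t"
    unfolding trace_nn_eq Kpos_mass_def by (subst nn_integral_cmult[symmetric]) (auto intro!: nn_integral_mono)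
qed

text \<open>Bridge from extended nonnegative integrals to gauge integrals. Since
  \<open>enn2real\<close> sends infinity to \<open>0\<close>, finiteness is required both pointwise
  on \<open>A\<close> and for the total.\<close>

lemma integral_enn2real:
  fixes g :: "real \<Rightarrow> ennreal"
  assumes [measurable]: "g \<in> borel_measurable borel" "A \<in> sets borel"
    and fin: "\<And>x. x \<in> A \<Longrightarrow> g x < \<infinity>" "(\<integral>\<^sup>+x. g x * indicator A x \<partial>lborel) < \<infinity>"
  shows "integral A (\<lambda>x. complex_of_real (enn2real (g x))) = of_real (enn2real (\<integral>\<^sup>+x. g x * indicator A x \<partial>lborel))"
proof -
  have eq: "(\<integral>\<^sup>+x. g x * indicator A x \<partial>lborel) = (\<integral>\<^sup>+x. ennreal (indicator A x * enn2real (g x)) \<partial>lborel)"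
    using fin(1) by (intro nn_integral_cong) (auto simp: indicator_def less_top)
  have "((\<lambda>x. indicator A x * enn2real (g x)) has_integral enn2real (\<integral>\<^sup>+x. g x * indicator A x \<partial>lborel)) UNIV"
    using fin(2) by (intro nn_integral_has_integral) (auto simp: eq)
  then have "((\<lambda>x. enn2real (g x)) has_integral enn2real (\<integral>\<^sup>+x. g x * indicator A x \<partial>lborel)) A"
    by (rule has_integral_restrict_UNIV[THEN iffD1, OF has_integral_eq[rotated]]) (simp add: indicator_def)
  from has_integral_linear[OF this bounded_linear_of_real[where 'a = complex]]
  show ?thesis by (simp add: o_def integral_unique)
qed

text \<open>The bridge is crossed once for each of the three integrals. For fixed \<open>x\<close>
  the factors \<open>NEpos\<close> are bounded and the kernel has finite mass, which makes the two
  inner integrals finite. These bounds blow up as \<open>x\<close> tends to \<open>0\<close>, so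
  finiteness of the outer integral comes from \<open>trace_nn_bounds\<close> instead.\<close>

lemma Tr1_eq:
  assumes t: "0 < t"
  shows "Tr1 \<theta> t = of_real (enn2real (trace_nn (2 * kappa \<theta>) t))"
proof -
  define c where "c = 2 * kappa \<theta>"
  have Kth: "Kth \<theta> u = of_real (Kpos c u)" if "0 < u" for u
    using that by (simp add: Kth_eq Kpos_def c_def)
  define J1 where "J1 x s = (\<integral>\<^sup>+r. ennreal (NEpos x (t - s) * Kpos c (s - r) * NEpos x r) \<partial>lborel)" for x s
  define J2 where "J2 x = (\<integral>\<^sup>+s. J1 x s \<partial>lborel)" for x
  have [measurable]: "(\<lambda>w. J1 (f w) (g w)) \<in> borel_measurable M"
    if [measurable]: "f \<in> borel_measurable M" "g \<in> borel_measurable M" for f g and M :: "'z measure"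
    unfolding J1_def by measurable
  have [measurable]: "J2 \<in> borel_measurable borel" unfolding J2_def by measurable
  have Qfin: "Kpos_mass c t < \<infinity>" using Kpos_mass_eq[OF t] by simp
  have J1_le: "\<exists>B. \<forall>s. J1 x s \<le> ennreal B * indicator {0..t} s" if x: "0 \<le> x" for x
  proof -
    obtain M where M: "0 \<le> M" "\<And>r. NEpos x r \<le> M" using NEpos_bounded[OF x] by blast
    have "J1 x s \<le> ennreal (M * M * enn2real (Kpos_mass c t)) * indicator {0..t} s" for s
    proof (cases "0 \<le> s \<and> s \<le> t")
      case True
      have "J1 x s \<le> (\<integral>\<^sup>+r. ennreal (M * M) * (ennreal (Kpos c (s - r)) * indicator {..<s} (s - r)) \<partial>lborel)"
        unfolding J1_def
      proof (rule nn_integral_mono)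
        fix r
        show "ennreal (NEpos x (t - s) * Kpos c (s - r) * NEpos x r)
          \<le> ennreal (M * M) * (ennreal (Kpos c (s - r)) * indicator {..<s} (s - r))"
        proof (cases "0 < r")
          case True
          have "NEpos x (t - s) * NEpos x r * Kpos c (s - r) \<le> M * M * Kpos c (s - r)"
            using M NEpos_nonneg[OF x] Kpos_nonneg by (intro mult_right_mono mult_mono) auto
          then show ?thesis using True M
            by (simp add: ennreal_mult'[symmetric] mult_ac ennreal_leI)
        qed (simp add: NEpos_def)
      qed
      also have "\<dots> = ennreal (M * M) * (\<integral>\<^sup>+r. ennreal (Kpos c (s - r)) * indicator {..<s} (s - r) \<partial>lborel)"
        by (rule nn_integral_cmult) measurable
      also have "(\<integral>\<^sup>+r. ennreal (Kpos c (s - r)) * indicator {..<s} (s - r) \<partial>lborel) = Kpos_mass c s"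
        unfolding Kpos_mass_def by (subst (2) nn_integral_real_affine[where c = "- 1" and t = s]) auto
      also have "ennreal (M * M) * Kpos_mass c s \<le> ennreal (M * M) * Kpos_mass c t"
        using True by (intro mult_left_mono Kpos_mass_mono) auto
      also have "\<dots> = ennreal (M * M * enn2real (Kpos_mass c t))"
        using Qfin M by (simp add: ennreal_mult less_top)
      finally show ?thesis using True by simp
    next
      case False
      have "NEpos x (t - s) * Kpos c (s - r) * NEpos x r = 0" for r
        using False by (auto simp: NEpos_def Kpos_def)
      then show ?thesis unfolding J1_def by (simp only:) simp
    qed
    then show ?thesis by blast
  qed
  have J1_fin: "J1 x s < \<infinity>" if x: "0 \<le> x" for x s
  proof -
    obtain B where "J1 x s \<le> ennreal B * indicator {0..t} s" using J1_le[OF x] by blast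
    also have "\<dots> < \<infinity>" by (simp add: ennreal_mult_less_top indicator_def)
    finally show ?thesis .
  qed
  have J2_fin: "J2 x < \<infinity>" if x: "0 \<le> x" for x
  proof -
    obtain B where B: "\<And>s. J1 x s \<le> ennreal B * indicator {0..t} s" using J1_le[OF x] by blast
    have "J2 x \<le> (\<integral>\<^sup>+s. ennreal B * indicator {0..t} s \<partial>lborel)"
      unfolding J2_def by (intro nn_integral_mono B)
    also have "\<dots> < \<infinity>" using t by (simp add: nn_integral_cmult_indicator ennreal_mult_less_top)
    finally show ?thesis .
  qed
  have trace_nn: "trace_nn c t = (\<integral>\<^sup>+x. J2 x * indicator {0..1} x \<partial>lborel)"
    unfolding trace_nn_def J2_def J1_def ..
  have Tfin: "trace_nn c t < \<infinity>"
    using Qfin ennreal_less_top[of "1 / 2"]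
    by (intro order_le_less_trans[OF trace_nn_bounds(1)])
       (simp only: ennreal_mult_less_top infinity_ennreal_def simp_thms)
  have inner: "integral {0..s} (\<lambda>r. of_real (NE x (t - s)) * Kth \<theta> (s - r) * of_real (NE x r))
      = of_real (enn2real (J1 x s))" if x: "0 \<le> x" and s: "0 \<le> s" "s < t" for x s
  proof -
    define g where "g r = ennreal (NEpos x (t - s) * Kpos c (s - r) * NEpos x r)" for r
    have J: "J1 x s = (\<integral>\<^sup>+r. g r * indicator {0..s} r \<partial>lborel)"
      unfolding J1_def g_def by (intro nn_integral_cong) (auto simp: indicator_def NEpos_def Kpos_def)
    have "integral {0..s} (\<lambda>r. of_real (NE x (t - s)) * Kth \<theta> (s - r) * of_real (NE x r))
      = integral {0..s} (\<lambda>r. complex_of_real (enn2real (g r)))"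
    \<comment> \<open>Away from the two endpoints all time arguments are positive, so
      \<open>NEpos\<close> and \<open>Kpos\<close> agree with \<open>NE\<close> and
      \<open>Kth\<close>.\<close>
    proof (rule integral_spike[where S = "{0, s}"])
      fix r assume r: "r \<in> {0..s} - {0, s}"
      then have "NEpos x r = NE x r" "NEpos x (t - s) = NE x (t - s)"
        using s by (auto simp: NEpos_def)
      moreover have "enn2real (g r) = NEpos x (t - s) * Kpos c (s - r) * NEpos x r"
        unfolding g_def using NEpos_nonneg[OF x] Kpos_nonneg by (intro enn2real_ennreal mult_nonneg_nonneg)
      ultimately show "complex_of_real (enn2real (g r)) = of_real (NE x (t - s)) * Kth \<theta> (s - r) * of_real (NE x r)"
        using r s by (auto simp: Kth)
    qed simp
    also have "\<dots> = of_real (enn2real (\<integral>\<^sup>+r. g r * indicator {0..s} r \<partial>lborel))"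
      using J1_fin[OF x, of s] unfolding J by (intro integral_enn2real) (auto simp: g_def)
    finally show ?thesis unfolding J .
  qed
  have middle: "integral {0..t} (\<lambda>s. integral {0..s} (\<lambda>r. of_real (NE x (t - s)) * Kth \<theta> (s - r) * of_real (NE x r)))
      = of_real (enn2real (J2 x))" if x: "0 \<le> x" for x
  proof -
    have J: "J2 x = (\<integral>\<^sup>+s. J1 x s * indicator {0..t} s \<partial>lborel)"
    proof -
      obtain B where B: "\<And>s. J1 x s \<le> ennreal B * indicator {0..t} s" using J1_le[OF x] by blast
      have "J1 x s = J1 x s * indicator {0..t} s" for s
        using B[of s] by (auto simp: indicator_def)
      then show ?thesis unfolding J2_def by presburger
    qed
    have "integral {0..t} (\<lambda>s. integral {0..s} (\<lambda>r. of_real (NE x (t - s)) * Kth \<theta> (s - r) * of_real (NE x r)))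
      = integral {0..t} (\<lambda>s. complex_of_real (enn2real (J1 x s)))"
      by (rule integral_spike[where S = "{t}"]) (auto simp: inner[OF x])
    also have "\<dots> = of_real (enn2real (\<integral>\<^sup>+s. J1 x s * indicator {0..t} s \<partial>lborel))"
      using J1_fin[OF x] J2_fin[OF x] unfolding J by (intro integral_enn2real) auto
    finally show ?thesis unfolding J .
  qed
  have "Tr1 \<theta> t = integral {0..1} (\<lambda>x. complex_of_real (enn2real (J2 x)))"
    unfolding Tr1_def by (rule integral_cong) (auto simp: middle)
  also have "\<dots> = of_real (enn2real (\<integral>\<^sup>+x. J2 x * indicator {0..1} x \<partial>lborel))"
    using J2_fin Tfin unfolding trace_nn by (intro integral_enn2real) auto
  finally show ?thesis unfolding trace_nn c_def[symmetric] .
qed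

section \<open>The expansion\<close>

text \<open>The imaginary part of \<open>1 / (a + i pi)\<close> is
  \<open>- pi / (a^2 + pi^2)\<close>, here with \<open>a = ln y + 2 k\<close>. The factor
  \<open>exp (- t y)\<close> dominates the integrand on \<open>[1,\<infinity>)\<close>, so
  \<open>Im\<close> may be moved inside.\<close>

lemma Im_log_integral:
  assumes t: "0 < t"
  shows "1 / pi * Im (integral {1..} (\<lambda>y::real. of_real (exp (- t * y) / y) *
            inverse (of_real (ln y) + \<i> * of_real pi + 2 * of_real k)))
    = - (LINT y:{1..}|lborel. exp (- (t * y)) * (log_density (2 * k) y / y))"
proof -
  define f where "f y = of_real (exp (- t * y) / y) *
     inverse (of_real (ln y) + \<i> * of_real pi + 2 * of_real k :: complex)" for y :: real
  have d: "of_real (ln y) + \<i> * of_real pi + 2 * of_real k = of_real (ln y + 2 * k) + \<i> * of_real pi" for y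
    by simp
  have "set_integrable lborel {1..} f"
    unfolding set_integrable_def
  proof (rule Bochner_Integration.integrable_bound[OF exp_decay_integrable[OF t]], goal_cases)
    case 2
    have "cmod (f y) \<le> exp (- (t * y))" if y: "1 \<le> y" for y
    proof -
      have "cmod (f y) = exp (- (t * y)) / (y * cmod (of_real (ln y + 2 * k) + \<i> * of_real pi))"
        unfolding f_def d using y by (simp add: norm_mult norm_inverse divide_inverse del: of_real_add)
      also have "\<dots> \<le> exp (- (t * y)) / (1 * 1)"
        using y cmod_add_imag_ge[of pi "ln y + 2 * k"] pi_gt3
        by (intro divide_left_mono mult_mono mult_pos_pos) (linarith | simp del: of_real_add)+
      finally show ?thesis by simp
    qed
    then show ?case by (intro AE_I2) (auto simp: indicator_def)
  qed (unfold f_def, measurable)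
  then have "f integrable_on {1..}" by (rule set_borel_integral_eq_integral)
  then have "Im (integral {1..} f) = integral {1..} (\<lambda>y. Im (f y))"
    using integral_linear[OF _ bounded_linear_Im] by (fastforce simp: o_def)
  also have "\<dots> = integral {1..} (\<lambda>y. - pi * (exp (- (t * y)) * (log_density (2 * k) y / y)))"
  proof (rule integral_cong)
    fix y :: real
    have "Im (inverse (of_real (ln y + 2 * k) + \<i> * of_real pi)) = - pi * log_density (2 * k) y"
      by (simp add: log_density_def)
    then show "Im (f y) = - pi * (exp (- (t * y)) * (log_density (2 * k) y / y))"
      unfolding f_def d by (simp only: times_complex.sel Re_complex_of_real Im_complex_of_real) simp
  qed
  also have "\<dots> = - pi * integral {1..} (\<lambda>y. exp (- (t * y)) * (log_density (2 * k) y / y))"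
    by (rule integral_mult_right)
  also have "integral {1..} (\<lambda>y. exp (- (t * y)) * (log_density (2 * k) y / y)) =
     (LINT y:{1..}|lborel. exp (- (t * y)) * (log_density (2 * k) y / y))"
    using exp_log_density_over_y_integrable[of t "2 * k"] t by (intro set_borel_integral_eq_integral(2)[symmetric]) simp
  finally show ?thesis unfolding f_def by simp
qed

text \<open>The coefficient of \<open>t^(i+1)\<close>, obtained by integrating the series of
  \<open>(1 - exp (- t y)) / y\<close> termwise against the density over
  \<open>(0,1)\<close>.\<close>

definition cum_density_coeff :: "real \<Rightarrow> nat \<Rightarrow> real" where
  "cum_density_coeff c i = (- 1) ^ i / fact (Suc i) * (LINT y:{0<..<1}|lborel. y ^ i * log_density c y)"

lemma power_log_density_integrable: "set_integrable lborel {0<..<1} (\<lambda>y. y ^ i * log_density c y)"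
proof (rule set_integrable_bounded)
  fix y :: real assume y: "0 < y" "y < 1"
  have "y ^ i * log_density c y \<le> 1 * (1 / pi\<^sup>2)"
    using y log_density_le log_density_nonneg by (intro mult_mono power_le_one) auto
  then show "\<bar>y ^ i * log_density c y\<bar> \<le> 1 / pi\<^sup>2" using y log_density_nonneg by simp
qed measurable

text \<open>Taylor's formula for \<open>exp\<close> at \<open>- t y\<close>, divided by
  \<open>y\<close>. The remainder keeps the factor \<open>t^(M+1) y^M\<close>, and since
  \<open>t y \<le> 1\<close> its constant is uniform in \<open>y\<close>.\<close>

lemma cum_density_taylor:
  fixes t y :: real
  assumes t: "0 < t" "t \<le> 1" and y: "0 < y" "y < 1"
  shows "\<bar>cum_density c t y - (\<Sum>i<M. (- 1) ^ i / fact (Suc i) * t ^ Suc i * (y ^ i * log_density c y))\<bar> \<le> exp 1 * t ^ Suc M"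
proof -
  define x where "x = - (t * y)"
  obtain s where s: "\<bar>s\<bar> \<le> \<bar>x\<bar>"
    "exp x = (\<Sum>m<Suc M. x ^ m / fact m) + exp s / fact (Suc M) * x ^ Suc M"
    \<comment> \<open>Order \<open>Suc M\<close> for a sum of \<open>M\<close> terms: the constant
      term of the exponential cancels against \<open>1\<close>.\<close>
    using Maclaurin_exp_le[of x "Suc M"] by blast
  have x1: "\<bar>x\<bar> \<le> 1" using t y by (simp add: x_def abs_mult mult_le_one)
  have trm: "(- 1) ^ i / fact (Suc i) * t ^ Suc i * (y ^ i * log_density c y) = log_density c y * (- (x ^ Suc i / fact (Suc i)) / y)" for i
  proof -
    have "x ^ Suc i = - ((- 1) ^ i * t ^ Suc i * y ^ Suc i)"
      unfolding x_def by (simp add: power_minus[of "t * y"] power_mult_distrib)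
    then show ?thesis using y by (simp add: field_simps del: fact_Suc)
  qed
  have S: "(\<Sum>i<M. (- 1) ^ i / fact (Suc i) * t ^ Suc i * (y ^ i * log_density c y)) =
      log_density c y * (- (\<Sum>i<M. x ^ Suc i / fact (Suc i)) / y)"
    unfolding trm by (simp only: sum_distrib_left[symmetric] sum_divide_distrib[symmetric] sum_negf)
  have "1 - exp x = - (\<Sum>i<M. x ^ Suc i / fact (Suc i)) - exp s / fact (Suc M) * x ^ Suc M"
    unfolding s(2) sum.lessThan_Suc_shift by simp
  then have "cum_density c t y = log_density c y * ((- (\<Sum>i<M. x ^ Suc i / fact (Suc i)) - exp s / fact (Suc M) * x ^ Suc M) / y)"
    unfolding cum_density_def x_def[symmetric] by simp
  then have "cum_density c t y - (\<Sum>i<M. (- 1) ^ i / fact (Suc i) * t ^ Suc i * (y ^ i * log_density c y))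
      = - (log_density c y * (exp s / fact (Suc M) * (x ^ Suc M / y)))"
    unfolding S by (simp add: diff_divide_distrib right_diff_distrib del: fact_Suc power_Suc)
  also have "\<bar>\<dots>\<bar> = log_density c y * (exp s / fact (Suc M) * (t ^ Suc M * y ^ M))"
    using t y log_density_nonneg[of c y] by (simp add: x_def abs_mult power_abs power_mult_distrib del: fact_Suc)
  also have "\<dots> \<le> 1 * (exp 1 / 1 * (t ^ Suc M * 1))"
  proof (intro mult_mono frac_le)
    have "1 / pi\<^sup>2 \<le> 1" using pi_gt3 by (simp add: power2_eq_square) (smt (verit) mult_le_cancel_left1)
    then show "log_density c y \<le> 1" using log_density_le[of c y] by linarith
    show "exp s \<le> exp 1" using s(1) x1 by simp
    show "(1::real) \<le> fact (Suc M)" by (rule fact_ge_1)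
    show "y ^ M \<le> 1" using y by (intro power_le_one) auto
  qed (use t y in \<open>auto simp del: fact_Suc\<close>)
  finally show ?thesis by simp
qed

lemma cum_density_unit_expansion:
  assumes t: "0 < t" "t \<le> 1"
  shows "\<bar>(LINT y:{0<..<1}|lborel. cum_density c t y) - (\<Sum>i<M. cum_density_coeff c i * t ^ Suc i)\<bar> \<le> exp 1 * t ^ Suc M"
proof -
  define p where "p i y = (- 1) ^ i / fact (Suc i) * t ^ Suc i * (y ^ i * log_density c y)" for i :: nat and y :: real
  have p_int: "set_integrable lborel {0<..<1} (p i)" for i
    unfolding p_def by (intro set_integrable_mult_right power_log_density_integrable)
  have qi: "set_integrable lborel {0<..<1} (cum_density c t)" using t by (intro cum_density_integrable_unit) simp
  have Si: "set_integrable lborel {0<..<1} (\<lambda>y. \<Sum>i<M. p i y)"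
    using p_int unfolding set_integrable_def scaleR_sum_right by (intro Bochner_Integration.integrable_sum)
  have ri: "set_integrable lborel {0<..<1} (\<lambda>y. cum_density c t y - (\<Sum>i<M. p i y))"
    by (rule set_integral_diff(1)[OF qi Si])
  have "(\<Sum>i<M. cum_density_coeff c i * t ^ Suc i) = (\<Sum>i<M. LINT y:{0<..<1}|lborel. p i y)"
    unfolding p_def cum_density_coeff_def by (simp only: set_integral_mult_right) (simp add: mult_ac)
  also have "\<dots> = (LINT y:{0<..<1}|lborel. \<Sum>i<M. p i y)"
    using p_int unfolding set_integrable_def set_lebesgue_integral_def scaleR_sum_right
    by (intro Bochner_Integration.integral_sum[symmetric])
  finally have "(LINT y:{0<..<1}|lborel. cum_density c t y) - (\<Sum>i<M. cum_density_coeff c i * t ^ Suc i)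
     = (LINT y:{0<..<1}|lborel. cum_density c t y - (\<Sum>i<M. p i y))"
    using set_integral_diff(2)[OF qi Si] by simp
  also have "\<bar>\<dots>\<bar> \<le> (LINT y:{0<..<1}|lborel. \<bar>cum_density c t y - (\<Sum>i<M. p i y)\<bar>)"
    using set_integral_norm_bound[OF ri] by simp
  also have "\<dots> \<le> (LINT y:{0<..<1::real}|lborel. exp 1 * t ^ Suc M)"
    using set_integrable_abs[OF ri] cum_density_taylor[OF t]
    by (intro set_integral_mono) (auto simp: p_def intro: set_integrable_bounded)
  also have "\<dots> = exp 1 * t ^ Suc M"
    by (simp add: set_lebesgue_integral_def)
  finally show ?thesis .
qed

text \<open>The exponential series at \<open>1/t\<close> has nonnegative terms, so
  \<open>exp (1/t)\<close> is at least its single term of degree \<open>n\<close>. This makes the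
  error from cutting off at \<open>x = 1\<close> smaller than any power of \<open>t\<close>.\<close>

lemma exp_neg_inverse_le:
  fixes t :: real
  assumes "0 < t" shows "exp (- (1 / t)) \<le> fact n * t ^ n"
proof -
  have "(\<Sum>k\<in>{n}. (1 / t) ^ k /\<^sub>R fact k) \<le> exp (1 / t)"
    unfolding sums_unique[OF exp_converges[of "1 / t"]]
    using assms by (intro sum_le_suminf summable_exp_generic) auto
  then have "(1 / t) ^ n / fact n \<le> exp (1 / t)"
    by (simp add: divide_inverse mult.commute)
  then show ?thesis using assms by (simp add: exp_minus field_simps)
qed

lemma cum_density_integral_nonneg: "0 \<le> t \<Longrightarrow> 0 \<le> (LINT y:{0<..}|lborel. cum_density c t y)"
  unfolding set_lebesgue_integral_def
  by (intro Bochner_Integration.integral_nonneg) (auto simp: indicator_def cum_density_nonneg)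

text \<open>With \<open>I\<close> half the mass of the kernel, the trace lies between
  \<open>(1 - exp (- 1/t)) I\<close> and \<open>I\<close>. The mass increases with \<open>t\<close>,
  so \<open>I\<close> may be replaced by its value at \<open>1\<close> in the error.\<close>

lemma trace_nn_approx:
  assumes t: "0 < t" "t \<le> 1"
  shows "\<bar>enn2real (trace_nn c t) - (LINT y:{0<..}|lborel. cum_density c t y)\<bar>
    \<le> exp (- (1 / t)) * (LINT y:{0<..}|lborel. cum_density c 1 y)"
proof -
  define I where "I t = (LINT y:{0<..}|lborel. cum_density c t y)" for t
  have I0: "0 \<le> I t" if "0 \<le> t" for t
    unfolding I_def using that by (rule cum_density_integral_nonneg)
  have "ennreal (2 * I t) \<le> ennreal (2 * I 1)"
    using Kpos_mass_mono[OF t(2), of c] t unfolding I_def by (simp add: Kpos_mass_eq)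
  then have mono: "I t \<le> I 1" using I0[of 1] by simp
  have up: "trace_nn c t \<le> ennreal (I t)"
    using trace_nn_bounds(1)[of c t] I0[of t] t unfolding Kpos_mass_eq[OF t(1)] I_def[symmetric]
    by (simp add: ennreal_mult'[symmetric] del: ennreal_half)
  have low: "ennreal ((1 - exp (- (1 / t))) * I t) \<le> trace_nn c t"
    using trace_nn_bounds(2)[where c = c and t = t] I0[of t] t unfolding Kpos_mass_eq[OF t(1)] I_def[symmetric]
    by (simp add: ennreal_mult'[symmetric])
  have "trace_nn c t = ennreal (enn2real (trace_nn c t))"
    using up by (metis ennreal_enn2real ennreal_less_top order_le_less_trans)
  then obtain v where v: "trace_nn c t = ennreal v" "0 \<le> v" by (metis enn2real_nonneg)
  have "v \<le> I t" using up v I0[of t] t by simp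
  moreover have "(1 - exp (- (1 / t))) * I t \<le> v" using low v by simp
  moreover have "exp (- (1 / t)) * I t \<le> exp (- (1 / t)) * I 1" using mono by simp
  ultimately have "\<bar>v - I t\<bar> \<le> exp (- (1 / t)) * I 1"
    unfolding left_diff_distrib by linarith
  then show ?thesis unfolding I_def[symmetric] v(1) using v(2) by simp
qed

theorem theorem6p2:
  fixes \<theta> :: real
  assumes "0 \<le> \<theta>" and "\<theta> < pi" and "\<theta> \<noteq> pi / 2"
  shows "\<exists>b :: nat \<Rightarrow> complex. \<forall>N :: nat.
    (\<lambda>t::real. Tr1 \<theta> t - (\<Sum>j<N. b j * of_real t ^ j)
        - of_real ((1 / pi) * Im (integral {1..} (\<lambda>y::real.
              of_real (exp (- t * y) / y) *
              inverse (of_real (ln y) + \<i> * of_real pi + 2 * of_real (kappa \<theta>))))))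
    \<in> O[at_right 0](\<lambda>t. of_real t ^ N)"
proof -
  define c where "c = 2 * kappa \<theta>"
  \<comment> \<open>The constant coefficient comes from the term \<open>1\<close> on
    \<open>[1,\<infinity>)\<close>; the higher ones come from \<open>(0,1)\<close>, with the index
    shifted by one.\<close>
  define b where "b j = complex_of_real (case j of 0 \<Rightarrow> (LINT y:{1..}|lborel. log_density c y / y) | Suc i \<Rightarrow> cum_density_coeff c i)" for j
  define V where "V t = 1 / pi * Im (integral {1..} (\<lambda>y::real. of_real (exp (- t * y) / y) *
            inverse (of_real (ln y) + \<i> * of_real pi + 2 * of_real (kappa \<theta>))))" for t
  define E where "E N t = Tr1 \<theta> t - (\<Sum>j<N. b j * of_real t ^ j) - of_real (V t)" for N :: nat and t :: real
  have Suc: "E (Suc M) \<in> O[at_right 0](\<lambda>t. of_real t ^ Suc M)" for M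
  proof (rule bigoI)
    define C where "C = fact (Suc M) * (LINT y:{0<..}|lborel. cum_density c 1 y) + exp 1"
    have "\<forall>\<^sub>F t in at_right (0::real). 0 < t \<and> t \<le> 1"
      unfolding eventually_at_right_field by (rule exI[of _ 1]) auto
    then show "\<forall>\<^sub>F t in at_right 0. norm (E (Suc M) t) \<le> C * norm (complex_of_real t ^ Suc M)"
    proof eventually_elim
      case (elim t)
      then have t: "0 < t" "t \<le> 1" by auto
      have "V t = - (LINT y:{1..}|lborel. exp (- (t * y)) * (log_density c y / y))"
        unfolding V_def c_def by (rule Im_log_integral[OF t(1)])
      then have I: "(LINT y:{0<..}|lborel. cum_density c t y) = (LINT y:{0<..<1}|lborel. cum_density c t y)
          + (LINT y:{1..}|lborel. log_density c y / y) + V t"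
        using cum_density_integral(2)[of t c] t by simp
      have "(\<Sum>j<Suc M. b j * of_real t ^ j) =
          of_real ((LINT y:{1..}|lborel. log_density c y / y) + (\<Sum>i<M. cum_density_coeff c i * t ^ Suc i))"
        unfolding sum.lessThan_Suc_shift by (simp add: b_def)
      \<comment> \<open>The constant and the logarithmic integral cancel exactly; what remains is
        the error of the cut-off in \<open>x\<close> plus the Taylor remainder.\<close>
      then have "E (Suc M) t = of_real ((enn2real (trace_nn c t) - (LINT y:{0<..}|lborel. cum_density c t y)) +
         ((LINT y:{0<..<1}|lborel. cum_density c t y) - (\<Sum>i<M. cum_density_coeff c i * t ^ Suc i)))"
        unfolding E_def Tr1_eq[OF t(1)] c_def[symmetric] I by simp
      then have "norm (E (Suc M) t) = \<bar>(enn2real (trace_nn c t) - (LINT y:{0<..}|lborel. cum_density c t y)) +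
         ((LINT y:{0<..<1}|lborel. cum_density c t y) - (\<Sum>i<M. cum_density_coeff c i * t ^ Suc i))\<bar>"
        by (simp only: norm_of_real)
      also have "\<dots> \<le> exp (- (1 / t)) * (LINT y:{0<..}|lborel. cum_density c 1 y) + exp 1 * t ^ Suc M"
        using trace_nn_approx[OF t, of c] cum_density_unit_expansion[OF t, of c M]
        by (intro order_trans[OF abs_triangle_ineq] add_mono)
      also have "\<dots> \<le> (fact (Suc M) * t ^ Suc M) * (LINT y:{0<..}|lborel. cum_density c 1 y) + exp 1 * t ^ Suc M"
        using exp_neg_inverse_le[OF t(1), of "Suc M"] cum_density_integral_nonneg[of 1 c]
        by (intro add_right_mono mult_right_mono) auto
      also have "\<dots> = C * norm (complex_of_real t ^ Suc M)"
        using t by (simp add: C_def norm_power algebra_simps del: fact_Suc power_Suc)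
      finally show ?case .
    qed
  qed
  have "E N \<in> O[at_right 0](\<lambda>t. of_real t ^ N)" for N
  proof (cases N)
    \<comment> \<open>Follows from order \<open>1\<close> by adding back the bounded term
      \<open>b 0\<close>.\<close>
    case 0
    have "(\<lambda>t. complex_of_real t ^ Suc 0) \<in> O[at_right 0](\<lambda>_. 1)"
    proof (rule bigoI[where c = 1])
      show "\<forall>\<^sub>F t in at_right 0. norm (complex_of_real t ^ Suc 0) \<le> 1 * norm (1::complex)"
        unfolding eventually_at_right_field by (rule exI[of _ 1]) auto
    qed
    then have "E (Suc 0) \<in> O[at_right 0](\<lambda>_. 1)"
      using Suc[of 0] landau_o.big_trans by blast
    then have "(\<lambda>t. E (Suc 0) t + b 0) \<in> O[at_right 0](\<lambda>_. 1)"
      by (intro sum_in_bigo) auto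
    moreover have "(\<lambda>t. E (Suc 0) t + b 0) = E 0" by (simp add: E_def fun_eq_iff)
    ultimately show ?thesis unfolding 0 by simp
  qed (use Suc in simp)
  then show ?thesis unfolding E_def V_def by blast
qed

end
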